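(* The RTLSG structures for $\mathfrak{sl}(1,1)$ (on the Harish-Chandra superpair $(\mathbb K,\mathfrak{sl}(1,1))$) are parametrized by six parameters $c_1^{C^\ast},c_1^{D^\ast},d_1^{C^\ast},d_1^{D^\ast},c,d\in\mathbb K$ satisfying $$\det\begin{pmatrix}c_1^{C^\ast}&c_1^{D^\ast}\\d_1^{C^\ast}&d_1^{D^\ast}\end{pmatrix}(d-c)=1 ,$$ where the parameters are related to the structure by the formulas in the context.
   Context: $\mathbb K$ is $\mathbb R$ or $\mathbb C$ (smooth, resp. holomorphic setting). $\mathfrak g=\mathfrak{sl}(1,1)$ is the Lie superalgebra with even part spanned by $H^+$ and odd part spanned by $C,D$, with $[C,D]=H^+$, $[C,C]=[D,D]=0$, $[H^+,C]=[H^+,D]=0$ (in $2\times2$ matrices: $H^+$ the identity, $C=\begin{pmatrix}0&1\\0&0\end{pmatrix}$, $D=\begin{pmatrix}0&0\\1&0\end{pmatrix}$); $C^\ast,D^\ast$ is the dual basis of $C,D$. Let $G=\mathbb K$ be the simply connected Lie group with Lie algebra $\mathfrak g_{\bar0}=\mathbb KH^+$, and $\mathcal O_G$ its sheaf of smooth, resp. holomorphic, functions. An RTLSG (representation-theoretical Lie supergroup) structure on $(\mathbb K,\mathfrak g)$ is a Lie superalgebra representation $\rho:\mathfrak g\to\mathrm{Der}(\mathcal F)$, written $X.f=\rho(X)(f)$, by superderivations of $\mathcal F=\mathcal O_G\otimes\Lambda\mathfrak g_{\bar1}^\ast$ such that $X\in\mathfrak g_{\bar0}$ acts on $\mathcal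 O_G$ by left-invariant derivation and on $\alpha\in\mathfrak g_{\bar1}^\ast$ by $X.\alpha=\alpha([\cdot,X])$ (which is $0$ here), and such that $f\in\mathcal F$ with $X.f\equiv0$ for all $X\in\mathfrak g$ implies $f\in\mathbb K$. Let $f$ be the function on $G$ with $H^+.f=f$, $f(e)=1$. Every such structure has unique constants in $\mathbb K$ with $C.f=c_{C^\ast}fC^\ast+c_{D^\ast}fD^\ast$, $D.f=d_{C^\ast}fC^\ast+d_{D^\ast}fD^\ast$, $C.C^\ast=c_1^{C^\ast}+c_\wedge^{C^\ast}C^\ast\wedge D^\ast$, and (with $f_{2,-2}$, $f_{-2,2}$ restricting to $1$) $C.D^\ast=c_1^{D^\ast}+c_\wedge^{D^\ast}C^\ast\wedge D^\ast$, $D.C^\ast=d_1^{C^\ast}+d_\wedge^{C^\ast}C^\ast\wedge D^\ast$, $D.D^\ast=d_1^{D^\ast}+d_\wedge^{D^\ast}C^\ast\wedge D^\ast$. The parameters $c,d$ are defined by $$(c_{C^\ast},c_{D^\ast})=(c_1^{D^\ast}c,\,-c_1^{C^\ast}c),\qquad(d_{C^\ast},d_{D^\ast})=(d_1^{D^\ast}d,\,-d_1^{C^\ast}d).$$ "Parametrized" means: each RTLSG structure determines a unique such tuple $(c_1^{C^\ast},c_1^{D^\ast},d_1^{C^\ast},d_1^{D^\ast},c,d)$ and each tuple satisfying the condition comes from exactly one RTLSG structure. *)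

theory Defs
  imports "HOL-Analysis.Analysis"
begin

datatype odd_basis = Cgen | Dgen

datatype sl11_basis = Hplus | Odd odd_basis

instance odd_basis :: finite
proof
  have "(UNIV :: odd_basis set) = {Cgen, Dgen}"
    using odd_basis.exhaust by blast
  then show "finite (UNIV :: odd_basis set)" by (metis finite.emptyI finite.insertI)
qed

instance sl11_basis :: finite
proof
  have "(UNIV :: sl11_basis set) = insert Hplus (range Odd)"
    using sl11_basis.exhaust by blast
  then show "finite (UNIV :: sl11_basis set)" by (metis finite finite_imageI finite.insertI)
qed

text \<open>The linear order only fixes signs in the exterior algebra below.\<close>

instantiation odd_basis :: linorder
begin

definition less_eq_odd_basis :: "odd_basis \<Rightarrow> odd_basis \<Rightarrow> bool" where
  "less_eq_odd_basis x y \<longleftrightarrow> x = Cgen \<or> y = Dgen"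

definition less_odd_basis :: "odd_basis \<Rightarrow> odd_basis \<Rightarrow> bool" where
  "less_odd_basis x y \<longleftrightarrow> x = Cgen \<and> y = Dgen"

instance
  by standard (auto simp: less_eq_odd_basis_def less_odd_basis_def intro: odd_basis.exhaust)

end

type_synonym 'k sl11 = "'k ^ sl11_basis"

abbreviation sl11_H :: "'k::field sl11" where "sl11_H \<equiv> axis Hplus 1"
abbreviation sl11_C :: "'k::field sl11" where "sl11_C \<equiv> axis (Odd Cgen) 1"
abbreviation sl11_D :: "'k::field sl11" where "sl11_D \<equiv> axis (Odd Dgen) 1"

text \<open>The bilinear superbracket with \<open>[C,D] = [D,C] = H\<close> and all other brackets of basis
  vectors equal to 0.\<close>

definition sl11_bracket :: "'k::field sl11 \<Rightarrow> 'k sl11 \<Rightarrow> 'k sl11" where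
  "sl11_bracket X Y =
     (X $ Odd Cgen * Y $ Odd Dgen + X $ Odd Dgen * Y $ Odd Cgen) *s sl11_H"

text \<open>Throughout, a parity is a natural number that matters only modulo 2.\<close>

definition sl11_homogeneous :: "nat \<Rightarrow> 'k::field sl11 \<Rightarrow> bool" where
  "sl11_homogeneous p X \<longleftrightarrow>
     (if even p then (\<forall>i. X $ Odd i = 0) else X $ Hplus = 0)"

definition sl11_matrix :: "'k::field sl11 \<Rightarrow> 'k ^ 2 ^ 2" where
  "sl11_matrix X = vector [vector [X $ Hplus, X $ Odd Cgen], vector [X $ Odd Dgen, X $ Hplus]]"

lemma sl11_matrix_bracket:
  assumes "sl11_homogeneous p X" "sl11_homogeneous q Y"
  shows "sl11_matrix (sl11_bracket X Y) =
    sl11_matrix X ** sl11_matrix Y - (\<chi> i j. (- 1) ^ (p * q) * (sl11_matrix Y ** sl11_matrix X) $ i $ j)"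
  using assms
  by (cases "even p"; cases "even q")
    (auto simp: sl11_homogeneous_def sl11_matrix_def sl11_bracket_def vec_eq_iff forall_2
      matrix_matrix_mult_def sum_2 axis_def algebra_simps)

text \<open>The exterior algebra of the vector space with basis indexed by \<open>'i\<close>: the coefficient
  at \<open>S\<close> belongs to the wedge product of the elements of \<open>S\<close> in increasing order.\<close>

type_synonym ('k, 'i) ext = "'k ^ ('i set)"

definition wedge :: "('k::field, 'i::{finite,linorder}) ext \<Rightarrow> ('k, 'i) ext \<Rightarrow> ('k, 'i) ext"
    (infixl "\<and>\<^sub>\<Lambda>" 70) where
  "a \<and>\<^sub>\<Lambda> b = (\<chi> S. \<Sum>T\<in>Pow S.
     (- 1) ^ card {(i, j). i \<in> T \<and> j \<in> S - T \<and> j < i} * a $ T * b $ (S - T))"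

abbreviation ext_one :: "('k::field, 'i::finite) ext" where
  "ext_one \<equiv> axis {} 1"

abbreviation ext_gen :: "'i \<Rightarrow> ('k::field, 'i::finite) ext" where
  "ext_gen i \<equiv> axis {i} 1"

text \<open>The generator of index \<open>i\<close> is the member of the basis dual to \<open>C, D\<close> belonging to
  \<open>Odd i\<close>.\<close>

abbreviation Cstar :: "('k::field, odd_basis) ext" where "Cstar \<equiv> ext_gen Cgen"
abbreviation Dstar :: "('k::field, odd_basis) ext" where "Dstar \<equiv> ext_gen Dgen"

text \<open>\<open>\<O>\<close> assigns to an open \<open>U\<close> the functions that are smooth (holomorphic) on \<open>U\<close>; only
  their values on \<open>U\<close> matter. A section of \<open>\<O> \<otimes> \<Lambda>\<close> over \<open>U\<close> is therefore normalised to vanish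
  outside \<open>U\<close>, so that equality of sections is equality of functions.\<close>

type_synonym 'k sheaf_of_functions = "'k set \<Rightarrow> ('k \<Rightarrow> 'k) set"
type_synonym 'k super_fun = "'k \<Rightarrow> ('k, odd_basis) ext"

definition smooth_functions :: "real sheaf_of_functions" where
  "smooth_functions U = {f. \<forall>n. \<forall>x\<in>U. (deriv ^^ n) f field_differentiable (at x)}"

definition holomorphic_functions :: "complex sheaf_of_functions" where
  "holomorphic_functions U = {f. f holomorphic_on U}"

definition sections :: "'k::field sheaf_of_functions \<Rightarrow> 'k set \<Rightarrow> 'k super_fun set" where
  "sections \<O> U = {s. (\<forall>S. (\<lambda>x. s x $ S) \<in> \<O> U) \<and> (\<forall>x. x \<notin> U \<longrightarrow> s x = 0)}"

definition restr :: "'k set \<Rightarrow> 'k::field super_fun \<Rightarrow> 'k super_fun" where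
  "restr U s = (\<lambda>x. if x \<in> U then s x else 0)"

definition section_homogeneous :: "nat \<Rightarrow> 'k::field super_fun \<Rightarrow> bool" where
  "section_homogeneous p s \<longleftrightarrow> (\<forall>x S. s x $ S \<noteq> 0 \<longrightarrow> even (card S + p))"

type_synonym 'k sheaf_map = "'k set \<Rightarrow> 'k super_fun \<Rightarrow> 'k super_fun"

text \<open>The last clause gives junk arguments a fixed value, so that equality of sheaf morphisms is
  equality of functions.\<close>

definition sheaf_endomorphism ::
    "'k::{real_normed_field,banach} sheaf_of_functions \<Rightarrow> 'k sheaf_map \<Rightarrow> bool" where
  "sheaf_endomorphism \<O> \<phi> \<longleftrightarrow>
     (\<forall>U. open U \<longrightarrow> (\<forall>s\<in>sections \<O> U. \<phi> U s \<in> sections \<O> U)) \<and>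
     (\<forall>U. open U \<longrightarrow> (\<forall>s\<in>sections \<O> U. \<forall>t\<in>sections \<O> U.
        \<phi> U (\<lambda>x. s x + t x) = (\<lambda>x. \<phi> U s x + \<phi> U t x))) \<and>
     (\<forall>U. open U \<longrightarrow> (\<forall>a. \<forall>s\<in>sections \<O> U.
        \<phi> U (\<lambda>x. a *s s x) = (\<lambda>x. a *s \<phi> U s x))) \<and>
     (\<forall>U V. open U \<longrightarrow> open V \<longrightarrow> V \<subseteq> U \<longrightarrow> (\<forall>s\<in>sections \<O> U.
        \<phi> V (restr V s) = restr V (\<phi> U s))) \<and>
     (\<forall>U s. \<not> (open U \<and> s \<in> sections \<O> U) \<longrightarrow> \<phi> U s = (\<lambda>x. 0))"

definition superderivation ::
    "'k::{real_normed_field,banach} sheaf_of_functions \<Rightarrow> nat \<Rightarrow> 'k sheaf_map \<Rightarrow> bool" where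
  "superderivation \<O> p \<phi> \<longleftrightarrow> sheaf_endomorphism \<O> \<phi> \<and>
     (\<forall>U q. open U \<longrightarrow> (\<forall>s\<in>sections \<O> U. section_homogeneous q s \<longrightarrow>
        section_homogeneous (p + q) (\<phi> U s))) \<and>
     (\<forall>U q. open U \<longrightarrow> (\<forall>s\<in>sections \<O> U. \<forall>t\<in>sections \<O> U. section_homogeneous q s \<longrightarrow>
        \<phi> U (\<lambda>x. s x \<and>\<^sub>\<Lambda> t x) =
          (\<lambda>x. \<phi> U s x \<and>\<^sub>\<Lambda> t x + (- 1) ^ (p * q) *s (s x \<and>\<^sub>\<Lambda> \<phi> U t x))))"

text \<open>A superderivation of mixed parity is a sum of an even and an odd one, so linearity of
  \<open>\<rho>\<close> and its values on homogeneous elements determine everything.\<close>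

definition sl11_representation ::
    "'k::{real_normed_field,banach} sheaf_of_functions \<Rightarrow> ('k sl11 \<Rightarrow> 'k sheaf_map) \<Rightarrow> bool" where
  "sl11_representation \<O> \<rho> \<longleftrightarrow>
     (\<forall>X Y U s. \<rho> (X + Y) U s = (\<lambda>x. \<rho> X U s x + \<rho> Y U s x)) \<and>
     (\<forall>a X U s. \<rho> (a *s X) U s = (\<lambda>x. a *s \<rho> X U s x)) \<and>
     (\<forall>p X. sl11_homogeneous p X \<longrightarrow> superderivation \<O> p (\<rho> X)) \<and>
     (\<forall>p q X Y U. sl11_homogeneous p X \<longrightarrow> sl11_homogeneous q Y \<longrightarrow> open U \<longrightarrow>
        (\<forall>s\<in>sections \<O> U. \<rho> (sl11_bracket X Y) U s =
          (\<lambda>x. \<rho> X U (\<rho> Y U s) x - (- 1) ^ (p * q) *s \<rho> Y U (\<rho> X U s) x)))"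

text \<open>On the group \<open>(\<K>, +)\<close> with Lie algebra \<open>\<K> H\<close>, the left-invariant derivation given by
  \<open>a H\<close> is \<open>a d/dx\<close>. The third clause is \<open>X.\<alpha> = \<alpha>([\<sqdot>,X])\<close> for \<open>\<alpha>\<close> a dual basis vector.\<close>

definition sl11_RTLSG ::
    "'k::{real_normed_field,banach} sheaf_of_functions \<Rightarrow> ('k sl11 \<Rightarrow> 'k sheaf_map) \<Rightarrow> bool" where
  "sl11_RTLSG \<O> \<rho> \<longleftrightarrow> sl11_representation \<O> \<rho> \<and>
     (\<forall>X U f. sl11_homogeneous 0 X \<longrightarrow> open U \<longrightarrow> f \<in> \<O> U \<longrightarrow>
        \<rho> X U (restr U (\<lambda>x. f x *s ext_one)) =
          restr U (\<lambda>x. (X $ Hplus * deriv f x) *s ext_one)) \<and>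
     (\<forall>X U i. sl11_homogeneous 0 X \<longrightarrow> open U \<longrightarrow>
        \<rho> X U (restr U (\<lambda>x. ext_gen i)) =
          restr U (\<lambda>x. \<Sum>j\<in>UNIV. (sl11_bracket (axis (Odd j) 1) X $ Odd i) *s ext_gen j)) \<and>
     (\<forall>s\<in>sections \<O> UNIV. (\<forall>X. \<rho> X UNIV s = (\<lambda>x. 0)) \<longrightarrow> (\<exists>k. s = (\<lambda>x. k *s ext_one)))"

text \<open>The function \<open>f\<close> with \<open>H.f = f\<close> and \<open>f(0) = 1\<close> is \<open>exp\<close>.\<close>

definition sl11_constants ::
    "('k::{real_normed_field,banach} sl11 \<Rightarrow> 'k sheaf_map) \<Rightarrow>
      'k \<Rightarrow> 'k \<Rightarrow> 'k \<Rightarrow> 'k \<Rightarrow> 'k \<Rightarrow> 'k \<Rightarrow> 'k \<Rightarrow> 'k \<Rightarrow> 'k \<Rightarrow> 'k \<Rightarrow> 'k \<Rightarrow> 'k \<Rightarrow> bool" where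
  "sl11_constants \<rho> c_Cs c_Ds d_Cs d_Ds c1_Cs c1_Ds d1_Cs d1_Ds cw_Cs cw_Ds dw_Cs dw_Ds \<longleftrightarrow>
     \<rho> sl11_C UNIV (\<lambda>x. exp x *s ext_one) = (\<lambda>x. (c_Cs * exp x) *s Cstar + (c_Ds * exp x) *s Dstar) \<and>
     \<rho> sl11_D UNIV (\<lambda>x. exp x *s ext_one) = (\<lambda>x. (d_Cs * exp x) *s Cstar + (d_Ds * exp x) *s Dstar) \<and>
     \<rho> sl11_C UNIV (\<lambda>x. Cstar) = (\<lambda>x. c1_Cs *s ext_one + cw_Cs *s (Cstar \<and>\<^sub>\<Lambda> Dstar)) \<and>
     \<rho> sl11_C UNIV (\<lambda>x. Dstar) = (\<lambda>x. c1_Ds *s ext_one + cw_Ds *s (Cstar \<and>\<^sub>\<Lambda> Dstar)) \<and>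
     \<rho> sl11_D UNIV (\<lambda>x. Cstar) = (\<lambda>x. d1_Cs *s ext_one + dw_Cs *s (Cstar \<and>\<^sub>\<Lambda> Dstar)) \<and>
     \<rho> sl11_D UNIV (\<lambda>x. Dstar) = (\<lambda>x. d1_Ds *s ext_one + dw_Ds *s (Cstar \<and>\<^sub>\<Lambda> Dstar))"

definition sl11_parameters ::
    "('k::{real_normed_field,banach} sl11 \<Rightarrow> 'k sheaf_map) \<Rightarrow> 'k \<times> 'k \<times> 'k \<times> 'k \<times> 'k \<times> 'k \<Rightarrow> bool" where
  "sl11_parameters \<rho> = (\<lambda>(c1_Cs, c1_Ds, d1_Cs, d1_Ds, c, d).
     \<exists>c_Cs c_Ds d_Cs d_Ds cw_Cs cw_Ds dw_Cs dw_Ds.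
       sl11_constants \<rho> c_Cs c_Ds d_Cs d_Ds c1_Cs c1_Ds d1_Cs d1_Ds cw_Cs cw_Ds dw_Cs dw_Ds \<and>
       (c_Cs, c_Ds) = (c1_Ds * c, - c1_Cs * c) \<and>
       (d_Cs, d_Ds) = (d1_Ds * d, - d1_Cs * d))"

definition sl11_condition :: "'k::field \<times> 'k \<times> 'k \<times> 'k \<times> 'k \<times> 'k \<Rightarrow> bool" where
  "sl11_condition = (\<lambda>(c1_Cs, c1_Ds, d1_Cs, d1_Ds, c, d).
     det (vector [vector [c1_Cs, c1_Ds], vector [d1_Cs, d1_Ds]] :: 'k ^ 2 ^ 2) * (d - c) = 1)"

end

theory Submission
  imports Defs "HOL-Complex_Analysis.Cauchy_Integral_Formula"
begin

text \<open>
The sections form the functions of one even coordinate \<open>x\<close> and two odd coordinates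
\<open>\<theta>\<^sub>1 = C\<^sup>*\<close>, \<open>\<theta>\<^sub>2 = D\<^sup>*\<close>, and a superderivation is a vector field in these coordinates
(\<open>derivation_function\<close>, which rests on \<open>Hadamard\<close>, and \<open>derivation_expansion\<close>). The prescribed
action of \<open>H\<close> makes it \<open>\<partial>\<^sub>x\<close>. The fields \<open>C\<close> and \<open>D\<close> are odd and commute with \<open>\<partial>\<^sub>x\<close>, so their
coefficients are constants (\<open>invariant_odd_superderivation_eq_field_map\<close>):
\<open>C = (a \<theta>\<^sub>1 + b \<theta>\<^sub>2) \<partial>\<^sub>x + (p1 + w1 \<theta>\<^sub>1\<theta>\<^sub>2) \<partial>\<^sub>1 + (p2 + w2 \<theta>\<^sub>1\<theta>\<^sub>2) \<partial>\<^sub>2\<close>, and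
\<open>D = (a' \<theta>\<^sub>1 + b' \<theta>\<^sub>2) \<partial>\<^sub>x + (q1 + v1 \<theta>\<^sub>1\<theta>\<^sub>2) \<partial>\<^sub>1 + (q2 + v2 \<theta>\<^sub>1\<theta>\<^sub>2) \<partial>\<^sub>2\<close>.

The bracket relations are polynomial equations for these constants
(\<open>anticommutator_relations\<close>). The condition that only scalars are invariant excludes
\<open>(p1, p2) = 0\<close> and \<open>(q1, q2) = 0\<close> (\<open>odd_field_nonzero_on_generators\<close>). Then \<open>[C, C] = 0\<close> and
\<open>[D, D] = 0\<close> say that \<open>w1, w2, v1, v2\<close> are zero and that \<open>(a, b)\<close> and \<open>(a', b')\<close> are orthogonal to
\<open>(p1, p2)\<close> and \<open>(q1, q2)\<close>, that is, unique multiples \<open>c (p2, - p1)\<close> and \<open>d (q2, - q1)\<close>. What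
remains of \<open>[C, D] = H\<close> is the equation \<open>a q1 + b q2 + a' p1 + b' p2 = 1\<close>, which after this
substitution is the determinant condition (\<open>RTLSG_normal_form\<close>). Conversely the fields with these
coefficients satisfy all axioms (\<open>sl11_model_RTLSG\<close>).

Nothing in the argument distinguishes real from complex scalars once the structure sheaf is known
to consist of the infinitely differentiable functions, which over \<open>\<complex>\<close> are the holomorphic ones.
\<close>

section \<open>Infinitely differentiable functions\<close>

definition smooth_on :: "'k::real_normed_field set \<Rightarrow> ('k \<Rightarrow> 'k) \<Rightarrow> bool" where
  "smooth_on U f \<longleftrightarrow> (\<forall>n. \<forall>x\<in>U. (deriv ^^ n) f field_differentiable (at x))"

lemma has_field_derivative_cong_open:
  assumes "open U" "x \<in> U" "\<And>y. y \<in> U \<Longrightarrow> f y = g y" "(g has_field_derivative d) (at x)"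
  shows "(f has_field_derivative d) (at x)"
proof -
  have "eventually (\<lambda>y. f y = g y) (nhds x)"
    using assms(1-3) eventually_nhds by blast
  from DERIV_cong_ev[OF refl this refl] assms(4) show ?thesis by blast
qed

text \<open>The iterated derivatives of a function given by a formula rarely have a closed form. It suffices
to find a set of functions, containing the given one, that is closed under differentiation
on \<open>U\<close>; the higher derivatives then never leave this set.\<close>

lemma smooth_on_coinduct:
  assumes U: "open U" and f: "f \<in> A"
    and step: "\<And>g. g \<in> A \<Longrightarrow> \<exists>h\<in>A. \<forall>x\<in>U. (g has_field_derivative h x) (at x)"
  shows "smooth_on U f"
proof -
  have iter: "\<exists>h\<in>A. \<forall>x\<in>U. (deriv ^^ n) f x = h x" for n
  proof (induction n)
    case 0
    then show ?case using f by auto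
  next
    case (Suc n)
    then obtain h where h: "h \<in> A" "\<And>x. x \<in> U \<Longrightarrow> (deriv ^^ n) f x = h x" by blast
    from step[OF h(1)] obtain k where k: "k \<in> A" "\<And>x. x \<in> U \<Longrightarrow> (h has_field_derivative k x) (at x)"
      by blast
    have "(deriv ^^ Suc n) f x = k x" if "x \<in> U" for x
      using has_field_derivative_cong_open[OF U that, of "(deriv ^^ n) f" h] h(2) k(2)[OF that] by (simp add: DERIV_imp_deriv)
    then show ?case using k(1) by blast
  qed
  show ?thesis
    unfolding smooth_on_def
  proof (intro allI ballI)
    fix n x assume x: "x \<in> U"
    obtain h where h: "h \<in> A" "\<And>x. x \<in> U \<Longrightarrow> (deriv ^^ n) f x = h x" using iter by blast
    from step[OF h(1)] obtain k where "(h has_field_derivative k x) (at x)" using x by blast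
    then show "(deriv ^^ n) f field_differentiable (at x)"
      using has_field_derivative_cong_open[OF U x, of "(deriv ^^ n) f" h] h(2) unfolding field_differentiable_def by blast
  qed
qed

lemma smooth_on_has_derivative:
  assumes "smooth_on U f" "x \<in> U"
  shows "(f has_field_derivative deriv f x) (at x)"
proof -
  have "(deriv ^^ 0) f field_differentiable (at x)"
    using assms unfolding smooth_on_def by blast
  then show ?thesis by (simp add: DERIV_deriv_iff_field_differentiable)
qed

lemma smooth_on_deriv:
  assumes "smooth_on U f"
  shows "smooth_on U (deriv f)"
proof -
  have "(deriv ^^ n) (deriv f) = (deriv ^^ Suc n) f" for n
    by (simp only: funpow_Suc_right comp_apply)
  then show ?thesis using assms unfolding smooth_on_def by metis
qed

lemma smooth_on_cong:
  assumes U: "open U" and f: "smooth_on U f" and eq: "\<And>x. x \<in> U \<Longrightarrow> f x = g x"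
  shows "smooth_on U g"
proof (rule smooth_on_coinduct[OF U, where A = "{h. \<exists>k. smooth_on U k \<and> (\<forall>x\<in>U. h x = k x)}"])
  show "g \<in> {h. \<exists>k. smooth_on U k \<and> (\<forall>x\<in>U. h x = k x)}"
    using f eq by auto
  fix h assume "h \<in> {h. \<exists>k. smooth_on U k \<and> (\<forall>x\<in>U. h x = k x)}"
  then obtain k where k: "smooth_on U k" "\<And>x. x \<in> U \<Longrightarrow> h x = k x" by auto
  have "\<forall>x\<in>U. (h has_field_derivative deriv k x) (at x)"
    using has_field_derivative_cong_open[OF U, of _ h k] k(2) smooth_on_has_derivative[OF k(1)] by blast
  then show "\<exists>l\<in>{h. \<exists>k. smooth_on U k \<and> (\<forall>x\<in>U. h x = k x)}. \<forall>x\<in>U. (h has_field_derivative l x) (at x)"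
    using smooth_on_deriv[OF k(1)] by blast
qed

lemma smooth_on_subset: "smooth_on U f \<Longrightarrow> V \<subseteq> U \<Longrightarrow> smooth_on V f"
  unfolding smooth_on_def by blast

lemma smooth_on_affine:
  assumes "open U"
  shows "smooth_on U (\<lambda>x. a * x + b)"
proof (rule smooth_on_coinduct[OF assms, where A = "range (\<lambda>(a, b) x. a * x + b)"])
  show "(\<lambda>x. a * x + b) \<in> range (\<lambda>(a, b) x. a * x + b)" by auto
next
  fix g :: "'a \<Rightarrow> 'a" assume "g \<in> range (\<lambda>(a, b) x. a * x + b)"
  then obtain a b where g: "g = (\<lambda>x. a * x + b)" by auto
  have "\<forall>x\<in>U. (g has_field_derivative 0 * x + a) (at x)"
    unfolding g by (auto intro!: derivative_eq_intros)
  then show "\<exists>h\<in>range (\<lambda>(a, b) x. a * x + b). \<forall>x\<in>U. (g has_field_derivative h x) (at x)"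
    by (intro bexI[of _ "\<lambda>x. 0 * x + a"]) (auto intro: image_eqI[of _ _ "(0, a)"])
qed

lemma smooth_on_const: "open U \<Longrightarrow> smooth_on U (\<lambda>x. c)"
  using smooth_on_affine[of U 0 c] by simp

lemma smooth_on_ident: "open U \<Longrightarrow> smooth_on U (\<lambda>x. x)"
  using smooth_on_affine[of U 1 0] by simp

lemma smooth_on_exp: "open U \<Longrightarrow> smooth_on U (exp :: 'k::{real_normed_field,banach} \<Rightarrow> 'k)"
  by (rule smooth_on_coinduct[where A = "{exp}"]) (auto intro: DERIV_exp)

text \<open>The set of functions to which \<open>smooth_on_coinduct\<close> is applied for sums and products: by the
product rule it is closed under differentiation, so the general Leibniz formula is avoided.\<close>

inductive_set smooth_algebra :: "'k::real_normed_field set \<Rightarrow> ('k \<Rightarrow> 'k) set" for U where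
  base: "smooth_on U f \<Longrightarrow> f \<in> smooth_algebra U"
| add: "f \<in> smooth_algebra U \<Longrightarrow> g \<in> smooth_algebra U \<Longrightarrow> (\<lambda>x. f x + g x) \<in> smooth_algebra U"
| mult: "f \<in> smooth_algebra U \<Longrightarrow> g \<in> smooth_algebra U \<Longrightarrow> (\<lambda>x. f x * g x) \<in> smooth_algebra U"

lemma smooth_algebra_derivative:
  assumes "f \<in> smooth_algebra U"
  shows "\<exists>h\<in>smooth_algebra U. \<forall>x\<in>U. (f has_field_derivative h x) (at x)"
  using assms
proof induction
  case (base f)
  then show ?case
    by (meson smooth_algebra.base smooth_on_deriv smooth_on_has_derivative)
next
  case (add f g)
  then obtain h k where "h \<in> smooth_algebra U" "\<forall>x\<in>U. (f has_field_derivative h x) (at x)"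
    "k \<in> smooth_algebra U" "\<forall>x\<in>U. (g has_field_derivative k x) (at x)" by blast
  then show ?case
    by (intro bexI[of _ "\<lambda>x. h x + k x"]) (auto intro: DERIV_add smooth_algebra.add)
next
  case (mult f g)
  then obtain h k where "h \<in> smooth_algebra U" "\<forall>x\<in>U. (f has_field_derivative h x) (at x)"
    "k \<in> smooth_algebra U" "\<forall>x\<in>U. (g has_field_derivative k x) (at x)" by blast
  with mult show ?case
    by (intro bexI[of _ "\<lambda>x. h x * g x + k x * f x"])
       (auto intro!: DERIV_mult smooth_algebra.add smooth_algebra.mult)
qed

lemma smooth_on_algebra: "open U \<Longrightarrow> f \<in> smooth_algebra U \<Longrightarrow> smooth_on U f"
  by (rule smooth_on_coinduct[OF _ _ smooth_algebra_derivative])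

lemma smooth_on_add:
  "open U \<Longrightarrow> smooth_on U f \<Longrightarrow> smooth_on U g \<Longrightarrow> smooth_on U (\<lambda>x. f x + g x)"
  by (rule smooth_on_algebra[OF _ smooth_algebra.add[OF smooth_algebra.base smooth_algebra.base]])

lemma smooth_on_mult:
  "open U \<Longrightarrow> smooth_on U f \<Longrightarrow> smooth_on U g \<Longrightarrow> smooth_on U (\<lambda>x. f x * g x)"
  by (rule smooth_on_algebra[OF _ smooth_algebra.mult[OF smooth_algebra.base smooth_algebra.base]])

lemma smooth_on_diff:
  assumes "open U" "smooth_on U f" "smooth_on U g"
  shows "smooth_on U (\<lambda>x. f x - g x)"
  using smooth_on_add[OF assms(1,2) smooth_on_mult[OF assms(1) smooth_on_const[OF assms(1), of "-1"] assms(3)]]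
  by simp

text \<open>Over \<open>\<complex>\<close> the coinduction set is the set of all holomorphic functions. This equivalence lets the
smooth and the holomorphic case share one proof over any complete normed field.\<close>

lemma holomorphic_on_iff_smooth_on:
  assumes "open U"
  shows "f holomorphic_on U \<longleftrightarrow> smooth_on U f"
proof
  assume "smooth_on U f"
  then show "f holomorphic_on U"
    using smooth_on_has_derivative[of U f] assms holomorphic_on_open by blast
next
  assume f: "f holomorphic_on U"
  show "smooth_on U f"
  proof (rule smooth_on_coinduct[OF assms, where A = "{f. f holomorphic_on U}"])
    show "f \<in> {f. f holomorphic_on U}" using f by simp
  next
    fix g assume "g \<in> {f. f holomorphic_on U}"
    then show "\<exists>h\<in>{f. f holomorphic_on U}. \<forall>x\<in>U. (g has_field_derivative h x) (at x)"
      using assms holomorphic_deriv[of g U] holomorphic_derivI[of g U] by blast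
  qed
qed

text \<open>The quotient is \<open>g x = \<integral>\<^sub>0\<^sup>1 f' (a + t (x - a)) dt\<close>. Differentiation under the integral shows that
the functions \<open>\<integral>\<^sub>0\<^sup>1 t\<^sup>n f\<^bsup>(n+1)\<^esup> (a + t (x - a)) dt\<close> are the successive derivatives of \<open>g\<close>, so that
\<open>smooth_on_coinduct\<close> applies. The segments from \<open>a\<close> stay in the domain because it is a ball.\<close>

lemma Hadamard:
  fixes f :: "'k::{real_normed_field,banach} \<Rightarrow> 'k"
  assumes f: "smooth_on (ball a r) f" and "r > 0"
  shows "\<exists>g. smooth_on (ball a r) g \<and> (\<forall>x\<in>ball a r. f x = f a + (x - a) * g x)"
proof -
  define B where "B = ball a r"
  have B: "open B" "convex B" "a \<in> B" using \<open>r > 0\<close> by (auto simp: B_def)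
  have seg: "a + t *\<^sub>R (x - a) \<in> B" if "x \<in> B" "t \<in> cbox 0 (1::real)" for x t
  proof -
    have "(1 - t) *\<^sub>R a + t *\<^sub>R x \<in> B"
      using that B by (intro convexD) auto
    then show ?thesis by (simp add: algebra_simps)
  qed
  define d where "d n = (deriv ^^ n) f" for n
  have d: "(d n has_field_derivative d (Suc n) x) (at x)" if "x \<in> B" for n x
    using f that unfolding smooth_on_def d_def B_def
    by (auto simp: DERIV_deriv_iff_field_differentiable)
  have cont_d: "continuous_on B (d n)" for n
    using d by (meson DERIV_isCont continuous_at_imp_continuous_on)
  define F where "F n x t = t ^ n *\<^sub>R d (Suc n) (a + t *\<^sub>R (x - a))" for n x and t :: real
  define g where "g n x = integral (cbox 0 1) (F n x)" for n x
  have contF: "continuous_on (B \<times> cbox 0 1) (\<lambda>(x, t). F n x t)" for n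
    unfolding F_def case_prod_unfold
    by (intro continuous_intros continuous_on_compose2[OF cont_d]) (auto intro: seg)
  have contF1: "continuous_on (cbox 0 1) (F n x)" if "x \<in> B" for n x
    unfolding F_def
    by (intro continuous_intros continuous_on_compose2[OF cont_d]) (auto intro: seg that)
  have dF: "((\<lambda>x. F n x t) has_field_derivative F (Suc n) x t) (at x within B)"
    if "x \<in> B" "t \<in> cbox 0 1" for n x t
  proof -
    have "((\<lambda>x. a + t *\<^sub>R (x - a)) has_field_derivative of_real t) (at x within B)"
      by (auto intro!: derivative_eq_intros simp: scaleR_conv_of_real)
    from DERIV_chain2[OF d[OF seg[OF that]] this]
    have "((\<lambda>x. d (Suc n) (a + t *\<^sub>R (x - a))) has_field_derivative
        d (Suc (Suc n)) (a + t *\<^sub>R (x - a)) * of_real t) (at x within B)" .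
    from DERIV_cmult[OF this, of "of_real (t ^ n)"] show ?thesis
      by (simp add: F_def scaleR_conv_of_real mult_ac)
  qed
  have dg: "(g n has_field_derivative g (Suc n) x) (at x)" if "x \<in> B" for n x
  proof -
    have "(g n has_field_derivative g (Suc n) x) (at x within B)"
      unfolding g_def
      by (rule leibniz_rule_field_derivative[OF dF _ contF that B(2)])
         (assumption | intro integrable_continuous contF1)+
    then show ?thesis using at_within_open[OF that B(1)] by simp
  qed
  have "smooth_on B (g 0)"
    by (rule smooth_on_coinduct[OF B(1), where A = "range g"]) (use dg in auto)
  moreover have "f x = f a + (x - a) * g 0 x" if x: "x \<in> B" for x
  proof -
    have "((\<lambda>t. (x - a) * F 0 x t) has_integral f (a + 1 *\<^sub>R (x - a)) - f (a + 0 *\<^sub>R (x - a))) {0..1}"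
    proof (rule fundamental_theorem_of_calculus)
      fix t :: real assume t: "t \<in> {0..1}"
      have 1: "((\<lambda>t. a + t *\<^sub>R (x - a)) has_vector_derivative (x - a)) (at t within {0..1})"
        by (auto intro!: derivative_eq_intros)
      have 2: "(f has_field_derivative d 1 (a + t *\<^sub>R (x - a))) (at (a + t *\<^sub>R (x - a)) within (\<lambda>t. a + t *\<^sub>R (x - a)) ` {0..1})"
        using d[OF seg[OF x], of t 0] t by (auto simp: d_def intro: has_field_derivative_at_within)
      show "((\<lambda>t. f (a + t *\<^sub>R (x - a))) has_vector_derivative (x - a) * F 0 x t) (at t within {0..1})"
        using field_vector_diff_chain_within[OF 1 2] by (simp add: o_def F_def)
    qed simp
    then have "((\<lambda>t. (x - a) * F 0 x t) has_integral (f x - f a)) (cbox 0 1)" by simp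
    moreover have "((\<lambda>t. (x - a) * F 0 x t) has_integral (x - a) * g 0 x) (cbox 0 1)"
      unfolding g_def by (intro has_integral_mult_right integrable_integral integrable_continuous contF1 x)
    ultimately have "f x - f a = (x - a) * g 0 x" by (rule has_integral_unique)
    then show ?thesis by (simp add: algebra_simps)
  qed
  ultimately show ?thesis unfolding B_def by blast
qed

section \<open>Coordinates on the exterior algebra\<close>

lemma odd_basis_set_cases: "S = {} \<or> S = {Cgen} \<or> S = {Dgen} \<or> S = {Cgen, Dgen}"
proof -
  have "S = (if Cgen \<in> S then {Cgen} else {}) \<union> (if Dgen \<in> S then {Dgen} else {})"
  proof (rule set_eqI)
    fix x show "x \<in> S \<longleftrightarrow> x \<in> (if Cgen \<in> S then {Cgen} else {}) \<union> (if Dgen \<in> S then {Dgen} else {})"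
      by (cases x) auto
  qed
  then show ?thesis by (cases "Cgen \<in> S"; cases "Dgen \<in> S") (simp_all add: insert_commute)
qed

lemma odd_basis_set_neqs [simp]:
  "{Cgen, Dgen} \<noteq> {Cgen}" "{Cgen, Dgen} \<noteq> {Dgen}"
  "{Cgen} \<noteq> {Cgen, Dgen}" "{Dgen} \<noteq> {Cgen, Dgen}"
  by auto

lemma ext_eq_iff:
  fixes u v :: "('k, odd_basis) ext"
  shows "u = v \<longleftrightarrow> u $ {} = v $ {} \<and> u $ {Cgen} = v $ {Cgen} \<and> u $ {Dgen} = v $ {Dgen} \<and>
    u $ {Cgen, Dgen} = v $ {Cgen, Dgen}"
proof
  assume eq: "u $ {} = v $ {} \<and> u $ {Cgen} = v $ {Cgen} \<and> u $ {Dgen} = v $ {Dgen} \<and>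
    u $ {Cgen, Dgen} = v $ {Cgen, Dgen}"
  have "u $ S = v $ S" for S
    using odd_basis_set_cases[of S] eq by (elim disjE) simp_all
  then show "u = v" by (simp add: vec_eq_iff)
qed simp

lemma axis_ext_component: "axis T a $ S = (if S = T then a else 0)"
  by (auto simp: axis_def)

lemma wedge_components:
  fixes u v :: "('k::field, odd_basis) ext"
  shows "(u \<and>\<^sub>\<Lambda> v) $ {} = u $ {} * v $ {}"
    and "(u \<and>\<^sub>\<Lambda> v) $ {Cgen} = u $ {} * v $ {Cgen} + u $ {Cgen} * v $ {}"
    and "(u \<and>\<^sub>\<Lambda> v) $ {Dgen} = u $ {} * v $ {Dgen} + u $ {Dgen} * v $ {}"
    and "(u \<and>\<^sub>\<Lambda> v) $ {Cgen, Dgen} =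
      u $ {} * v $ {Cgen, Dgen} + u $ {Cgen} * v $ {Dgen} - u $ {Dgen} * v $ {Cgen} +
      u $ {Cgen, Dgen} * v $ {}"
proof -
  have inv: "{(i, j). i \<in> {Cgen} \<and> j \<in> {Cgen, Dgen} - {Cgen} \<and> j < i} = {}"
    "{(i, j). i \<in> {Dgen} \<and> j \<in> {Cgen, Dgen} - {Dgen} \<and> j < i} = {(Dgen, Cgen)}"
    by (auto simp: less_odd_basis_def)
  have diff: "{Cgen, Dgen} - {Cgen} = {Dgen}" "{Cgen, Dgen} - {Dgen} = {Cgen}" by auto
  have sum: "(\<Sum>T\<in>Pow {Cgen, Dgen}. g T) = g {} + g {Cgen} + g {Dgen} + g {Cgen, Dgen}"
    for g :: "odd_basis set \<Rightarrow> 'k"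
  proof -
    have "Pow {Cgen, Dgen} = {{}, {Cgen}, {Dgen}, {Cgen, Dgen}}" by (auto simp: Pow_insert)
    then show ?thesis by (simp add: add.assoc)
  qed
  show "(u \<and>\<^sub>\<Lambda> v) $ {Cgen, Dgen} =
      u $ {} * v $ {Cgen, Dgen} + u $ {Cgen} * v $ {Dgen} - u $ {Dgen} * v $ {Cgen} +
      u $ {Cgen, Dgen} * v $ {}"
    unfolding wedge_def vec_lambda_beta sum inv unfolding diff by simp
  have sum1: "(\<Sum>T\<in>Pow {i}. g T) = g {} + g {i}" for g :: "odd_basis set \<Rightarrow> 'k" and i
  proof -
    have "Pow {i} = {{}, {i}}" by auto
    then show ?thesis by simp
  qed
  show "(u \<and>\<^sub>\<Lambda> v) $ {Cgen} = u $ {} * v $ {Cgen} + u $ {Cgen} * v $ {}"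
    "(u \<and>\<^sub>\<Lambda> v) $ {Dgen} = u $ {} * v $ {Dgen} + u $ {Dgen} * v $ {}"
    unfolding wedge_def vec_lambda_beta sum1 by simp_all
  show "(u \<and>\<^sub>\<Lambda> v) $ {} = u $ {} * v $ {}"
    by (simp add: wedge_def)
qed

lemmas ext_simps = ext_eq_iff wedge_components axis_ext_component

lemma Cstar_wedge_Dstar:
  "(Cstar :: ('k::field, odd_basis) ext) \<and>\<^sub>\<Lambda> Dstar = axis {Cgen, Dgen} 1"
  by (simp add: ext_simps)

definition sderiv :: "'k::real_normed_field super_fun \<Rightarrow> 'k super_fun" where
  "sderiv s x = (\<chi> S. deriv (\<lambda>y. s y $ S) x)"

lemma sderiv_eqI:
  assumes "\<And>S. ((\<lambda>y. s y $ S) has_field_derivative v $ S) (at x)"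
  shows "sderiv s x = v"
  using assms by (auto simp: sderiv_def vec_eq_iff intro!: DERIV_imp_deriv)

lemma sderiv_const [simp]: "sderiv (\<lambda>x. v) x = 0"
  by (rule sderiv_eqI) simp

lemma sderiv_exp:
  fixes v :: "('k::{real_normed_field,banach}, odd_basis) ext"
  shows "sderiv (\<lambda>x. exp x *s v) = (\<lambda>x. exp x *s v)"
  by (rule ext, rule sderiv_eqI) (auto intro!: derivative_eq_intros)

section \<open>Super vector fields with constant coefficients\<close>

text \<open>With coordinates \<open>x\<close> on \<open>\<K>\<close> and \<open>\<theta>\<^sub>1 = C\<^sup>*\<close>, \<open>\<theta>\<^sub>2 = D\<^sup>*\<close>, this is the vector field
\<open>h \<partial>\<^sub>x + (a \<theta>\<^sub>1 + b \<theta>\<^sub>2) \<partial>\<^sub>x + (p1 + w1 \<theta>\<^sub>1\<theta>\<^sub>2) \<partial>\<^sub>1 + (p2 + w2 \<theta>\<^sub>1\<theta>\<^sub>2) \<partial>\<^sub>2\<close> applied to a section with value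
\<open>v\<close> and derivative \<open>v'\<close> at a point. Keeping \<open>v\<close> and \<open>v'\<close> as independent arguments turns Leibniz
rules and commutators into polynomial identities in the coordinates.\<close>

definition field_value ::
    "'k::field \<Rightarrow> 'k \<Rightarrow> 'k \<Rightarrow> 'k \<Rightarrow> 'k \<Rightarrow> 'k \<Rightarrow> 'k \<Rightarrow>
      ('k, odd_basis) ext \<Rightarrow> ('k, odd_basis) ext \<Rightarrow> ('k, odd_basis) ext" where
  "field_value h a b p1 p2 w1 w2 v v' = h *s v' +
     axis {} (p1 * v $ {Cgen} + p2 * v $ {Dgen}) +
     axis {Cgen} (a * v' $ {} - p2 * v $ {Cgen, Dgen}) +
     axis {Dgen} (b * v' $ {} + p1 * v $ {Cgen, Dgen}) +
     axis {Cgen, Dgen} (a * v' $ {Dgen} - b * v' $ {Cgen} + w1 * v $ {Cgen} + w2 * v $ {Dgen})"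

lemma field_value_components:
  "field_value h a b p1 p2 w1 w2 v v' $ {} =
     h * v' $ {} + p1 * v $ {Cgen} + p2 * v $ {Dgen}"
  "field_value h a b p1 p2 w1 w2 v v' $ {Cgen} =
     h * v' $ {Cgen} + a * v' $ {} - p2 * v $ {Cgen, Dgen}"
  "field_value h a b p1 p2 w1 w2 v v' $ {Dgen} =
     h * v' $ {Dgen} + b * v' $ {} + p1 * v $ {Cgen, Dgen}"
  "field_value h a b p1 p2 w1 w2 v v' $ {Cgen, Dgen} =
     h * v' $ {Cgen, Dgen} + a * v' $ {Dgen} - b * v' $ {Cgen} + w1 * v $ {Cgen} + w2 * v $ {Dgen}"
  by (simp_all add: field_value_def axis_ext_component)

section \<open>Superderivations in coordinates\<close>

locale smooth_function_sheaf =
  fixes \<O> :: "'k::{real_normed_field,banach} sheaf_of_functions"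
  assumes mem_iff_smooth_on: "open U \<Longrightarrow> f \<in> \<O> U \<longleftrightarrow> smooth_on U f"
begin

lemma sections_iff:
  "open U \<Longrightarrow> s \<in> sections \<O> U \<longleftrightarrow>
     (\<forall>S. smooth_on U (\<lambda>x. s x $ S)) \<and> (\<forall>x. x \<notin> U \<longrightarrow> s x = 0)"
  by (simp add: sections_def mem_iff_smooth_on)

lemma const_section: "(\<lambda>x. v) \<in> sections \<O> UNIV"
  by (simp add: sections_iff smooth_on_const)

lemma restr_section:
  assumes U: "open U" and V: "open V" "V \<subseteq> U" and s: "\<And>S. smooth_on U (\<lambda>x. s x $ S)"
  shows "restr V s \<in> sections \<O> V"
proof -
  have "smooth_on V (\<lambda>x. restr V s x $ S)" for S
    by (rule smooth_on_cong[OF V(1) smooth_on_subset[OF s V(2)]]) (simp add: restr_def)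
  then show ?thesis by (simp add: sections_iff V restr_def)
qed

lemma function_section:
  assumes "open U" "smooth_on U f"
  shows "restr U (\<lambda>x. f x *s v) \<in> sections \<O> U"
  by (rule restr_section[OF assms(1,1)])
     (auto intro!: smooth_on_mult smooth_on_const assms)

lemma function_mult_section:
  assumes U: "open U" and f: "smooth_on U f" and s: "s \<in> sections \<O> U"
  shows "(\<lambda>x. f x *s s x) \<in> sections \<O> U"
  using s by (auto simp: sections_iff U intro!: smooth_on_mult f)

lemma add_section:
  assumes "open U" "s \<in> sections \<O> U" "t \<in> sections \<O> U"
  shows "(\<lambda>x. s x + t x) \<in> sections \<O> U"
  using assms by (auto simp: sections_iff intro!: smooth_on_add)

lemma section_has_derivative:
  assumes "open U" "s \<in> sections \<O> U" "x \<in> U"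
  shows "((\<lambda>y. s y $ S) has_field_derivative sderiv s x $ S) (at x)"
  using assms smooth_on_has_derivative by (auto simp: sections_iff sderiv_def)

lemma sderiv_smooth:
  assumes "open U" "s \<in> sections \<O> U"
  shows "smooth_on U (\<lambda>x. sderiv s x $ S)"
  using assms by (auto simp: sections_iff sderiv_def intro!: smooth_on_deriv)

lemma exp_section: "(\<lambda>x. exp x *s v) \<in> sections \<O> UNIV"
  by (auto simp: sections_iff intro!: smooth_on_mult smooth_on_const smooth_on_exp)

lemma ident_section: "(\<lambda>x. x *s v) \<in> sections \<O> UNIV"
  by (auto simp: sections_iff intro!: smooth_on_mult smooth_on_const smooth_on_ident)

context
  fixes p \<phi>
  assumes \<phi>: "superderivation \<O> p \<phi>"
begin

lemma derivation_section: "open U \<Longrightarrow> s \<in> sections \<O> U \<Longrightarrow> \<phi> U s \<in> sections \<O> U"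
  and derivation_add: "open U \<Longrightarrow> s \<in> sections \<O> U \<Longrightarrow> t \<in> sections \<O> U \<Longrightarrow>
    \<phi> U (\<lambda>x. s x + t x) = (\<lambda>x. \<phi> U s x + \<phi> U t x)"
  and derivation_scale: "open U \<Longrightarrow> s \<in> sections \<O> U \<Longrightarrow> \<phi> U (\<lambda>x. a *s s x) = (\<lambda>x. a *s \<phi> U s x)"
  and derivation_restr: "open U \<Longrightarrow> open V \<Longrightarrow> V \<subseteq> U \<Longrightarrow> s \<in> sections \<O> U \<Longrightarrow>
    \<phi> V (restr V s) = restr V (\<phi> U s)"
  and derivation_junk: "\<not> (open U \<and> s \<in> sections \<O> U) \<Longrightarrow> \<phi> U s = (\<lambda>x. 0)"
  using \<phi> by (simp_all add: superderivation_def sheaf_endomorphism_def)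

lemma derivation_parity: "open U \<Longrightarrow> s \<in> sections \<O> U \<Longrightarrow> section_homogeneous q s \<Longrightarrow>
    section_homogeneous (p + q) (\<phi> U s)"
  and derivation_wedge: "open U \<Longrightarrow> s \<in> sections \<O> U \<Longrightarrow> t \<in> sections \<O> U \<Longrightarrow>
    section_homogeneous q s \<Longrightarrow> \<phi> U (\<lambda>x. s x \<and>\<^sub>\<Lambda> t x) =
      (\<lambda>x. \<phi> U s x \<and>\<^sub>\<Lambda> t x + (- 1) ^ (p * q) *s (s x \<and>\<^sub>\<Lambda> \<phi> U t x))"
  using \<phi> by (simp_all add: superderivation_def)

lemma derivation_zero: "open U \<Longrightarrow> s \<in> sections \<O> U \<Longrightarrow> \<phi> U (\<lambda>x. 0) = (\<lambda>x. 0)"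
  using derivation_scale[of U s 0] by simp

text \<open>A function \<open>f\<close>, viewed as the section \<open>f \<otimes> 1\<close>, is even; hence no sign appears here, whatever the
parity of \<open>\<phi>\<close>.\<close>

lemma derivation_function_mult:
  assumes U: "open U" and f: "smooth_on U f" and t: "t \<in> sections \<O> U"
  shows "\<phi> U (\<lambda>x. f x *s t x) =
    (\<lambda>x. \<phi> U (restr U (\<lambda>x. f x *s ext_one)) x \<and>\<^sub>\<Lambda> t x + f x *s \<phi> U t x)"
proof -
  let ?s = "restr U (\<lambda>x. f x *s ext_one) :: 'k super_fun"
  have out: "t x = 0" "\<phi> U t x = 0" if "x \<notin> U" for x
    using t derivation_section[OF U t] that by (auto simp: sections_def)
  have 1: "(\<lambda>x. ?s x \<and>\<^sub>\<Lambda> t x) = (\<lambda>x. f x *s t x)"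
  proof
    fix x show "?s x \<and>\<^sub>\<Lambda> t x = f x *s t x"
      using out[of x] by (cases "x \<in> U") (simp_all add: restr_def ext_simps)
  qed
  have 2: "?s x \<and>\<^sub>\<Lambda> \<phi> U t x = f x *s \<phi> U t x" for x
    using out[of x] by (cases "x \<in> U") (simp_all add: restr_def ext_simps)
  have "section_homogeneous 0 ?s"
    by (auto simp: section_homogeneous_def restr_def axis_ext_component split: if_splits)
  from derivation_wedge[OF U function_section[OF U f] t this]
  show ?thesis unfolding 1 2 by simp
qed

lemma derivation_one: "\<phi> UNIV (\<lambda>x. ext_one) = (\<lambda>x. 0)"
proof -
  have "\<phi> UNIV (\<lambda>x. ext_one) = (\<lambda>x. \<phi> UNIV (\<lambda>x. ext_one) x \<and>\<^sub>\<Lambda> ext_one + \<phi> UNIV (\<lambda>x. ext_one) x)"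
    using derivation_function_mult[OF open_UNIV smooth_on_const[OF open_UNIV, of 1] const_section[of ext_one]]
    by (simp add: restr_def)
  then have "\<phi> UNIV (\<lambda>x. ext_one) x = \<phi> UNIV (\<lambda>x. ext_one) x \<and>\<^sub>\<Lambda> ext_one + \<phi> UNIV (\<lambda>x. ext_one) x" for x
    by metis
  moreover have "u \<and>\<^sub>\<Lambda> ext_one = u" for u :: "('k, odd_basis) ext"
    by (simp add: ext_simps)
  ultimately show ?thesis by (metis add_cancel_right_left)
qed

text \<open>A derivation of the functions is determined by its value on the coordinate \<open>x\<close>. Near a point
\<open>x\<^sub>0\<close> write \<open>f = f x\<^sub>0 + (x - x\<^sub>0) g\<close> by \<open>Hadamard\<close>. At \<open>x\<^sub>0\<close> the Leibniz rule
leaves only \<open>g x\<^sub>0\<close> times the value on \<open>x\<close>, and \<open>g x\<^sub>0\<close> is the derivative of \<open>f\<close> there. The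
decomposition is available on a ball, and this is enough because \<open>\<phi>\<close> commutes with restriction.\<close>

lemma derivation_function:
  assumes U: "open U" and f: "smooth_on U f" and x: "x \<in> U"
  shows "\<phi> U (restr U (\<lambda>y. f y *s ext_one)) x = deriv f x *s \<phi> UNIV (\<lambda>y. y *s ext_one) x"
proof -
  obtain r where r: "r > 0" "ball x r \<subseteq> U" using U x openE by blast
  define B where "B = ball x r"
  have B: "open B" "B \<subseteq> U" "x \<in> B" using r by (auto simp: B_def)
  obtain g where g: "smooth_on B g" "\<And>y. y \<in> B \<Longrightarrow> f y = f x + (y - x) * g y"
    using Hadamard[of x r f] smooth_on_subset[OF f r(2)] r(1) unfolding B_def by blast
  \<comment> \<open>As \<open>y - x\<close> vanishes at \<open>x\<close>, the product rule needs only that \<open>g\<close> is differentiable there.\<close>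
  have fx: "deriv f x = g x"
  proof (rule DERIV_imp_deriv, rule has_field_derivative_cong_open[OF B(1,3) g(2)])
    show "((\<lambda>y. f x + (y - x) * g y) has_field_derivative g x) (at x)"
      by (auto intro!: derivative_eq_intros smooth_on_has_derivative[OF g(1) B(3)])
  qed
  let ?one = "restr B (\<lambda>y. ext_one) :: 'k super_fun"
  let ?g = "restr B (\<lambda>y. g y *s ext_one) :: 'k super_fun"
  let ?l = "\<lambda>y. y - x"
  have l: "smooth_on B ?l" by (intro smooth_on_diff smooth_on_ident smooth_on_const B)
  have one: "?one \<in> sections \<O> B" by (rule restr_section[OF open_UNIV B(1)]) (auto intro: smooth_on_const)
  have gs: "?g \<in> sections \<O> B" by (rule function_section[OF B(1) g(1)])
  have U1: "(\<lambda>y::'k. ext_one) \<in> sections \<O> UNIV" by (rule const_section)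
  have \<phi>one: "\<phi> B ?one = (\<lambda>y. 0)"
    using derivation_restr[OF open_UNIV B(1) _ U1] by (simp add: derivation_one restr_def)
  have \<phi>l: "\<phi> B (restr B (\<lambda>y. ?l y *s ext_one)) x = \<phi> UNIV (\<lambda>y. y *s ext_one) x"
  proof -
    have "(\<lambda>y. ?l y *s ext_one) = (\<lambda>y. y *s ext_one + (- x) *s ext_one :: ('k, odd_basis) ext)"
      by (simp add: vec_eq_iff algebra_simps)
    moreover have "(\<lambda>y. ?l y *s ext_one) \<in> sections \<O> UNIV"
      by (auto simp: sections_iff intro!: smooth_on_mult smooth_on_diff smooth_on_ident smooth_on_const)
    ultimately have "\<phi> B (restr B (\<lambda>y. ?l y *s ext_one)) x =
        \<phi> UNIV (\<lambda>y. y *s ext_one + (- x) *s ext_one) x"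
      using derivation_restr[OF open_UNIV B(1)] B(3) by (simp add: restr_def)
    also have "\<dots> = \<phi> UNIV (\<lambda>y. y *s ext_one) x"
      unfolding derivation_add[OF open_UNIV ident_section const_section]
        derivation_scale[OF open_UNIV U1] derivation_one by simp
    finally show ?thesis .
  qed
  have eq: "restr B (restr U (\<lambda>y. f y *s ext_one)) = (\<lambda>y. f x *s ?one y + ?l y *s ?g y)"
  proof
    fix y
    show "restr B (restr U (\<lambda>y. f y *s ext_one)) y = f x *s ?one y + ?l y *s ?g y"
    proof (cases "y \<in> B")
      case True
      have "f y *s ext_one = f x *s ext_one + ?l y *s (g y *s ext_one :: ('k, odd_basis) ext)"
        by (subst g(2)[OF True]) (simp add: vec_eq_iff algebra_simps)
      then show ?thesis using True B(2) by (auto simp: restr_def)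
    qed (simp add: restr_def)
  qed
  have "\<phi> U (restr U (\<lambda>y. f y *s ext_one)) x = \<phi> B (restr B (restr U (\<lambda>y. f y *s ext_one))) x"
    using derivation_restr[OF U B(1,2) function_section[OF U f]] B(3) by (simp add: restr_def)
  also have "\<dots> = \<phi> B (\<lambda>y. f x *s ?one y) x + \<phi> B (\<lambda>y. ?l y *s ?g y) x"
    unfolding eq
    by (rule fun_cong[OF derivation_add[OF B(1) function_mult_section[OF B(1) smooth_on_const[OF B(1)] one]
        function_mult_section[OF B(1) l gs]]])
  also have "\<dots> = \<phi> UNIV (\<lambda>y. y *s ext_one) x \<and>\<^sub>\<Lambda> ?g x"
    unfolding derivation_scale[OF B(1) one] \<phi>one derivation_function_mult[OF B(1) l gs] \<phi>l by simp
  also have "\<dots> = g x *s \<phi> UNIV (\<lambda>y. y *s ext_one) x"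
    using B(3) by (simp add: restr_def ext_simps)
  finally show ?thesis by (simp add: fx)
qed

lemma derivation_const_multiple:
  assumes U: "open U" and f: "smooth_on U f" and x: "x \<in> U"
  shows "\<phi> U (\<lambda>y. f y *s restr U (\<lambda>y. v) y) x =
    (deriv f x *s \<phi> UNIV (\<lambda>y. y *s ext_one) x) \<and>\<^sub>\<Lambda> v + f x *s \<phi> UNIV (\<lambda>y. v) x"
proof -
  have "restr U (\<lambda>y. v) \<in> sections \<O> U"
    by (rule restr_section[OF open_UNIV U]) (auto intro: smooth_on_const)
  then have "\<phi> U (\<lambda>y. f y *s restr U (\<lambda>y. v) y) x =
      \<phi> U (restr U (\<lambda>x. f x *s ext_one)) x \<and>\<^sub>\<Lambda> restr U (\<lambda>y. v) x + f x *s \<phi> U (restr U (\<lambda>y. v)) x"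
    by (simp add: derivation_function_mult[OF U f])
  moreover have "\<phi> U (restr U (\<lambda>y. v)) = restr U (\<phi> UNIV (\<lambda>y. v))"
    by (rule derivation_restr[OF open_UNIV U _ const_section]) simp
  ultimately show ?thesis
    unfolding derivation_function[OF U f x] using x by (simp add: restr_def)
qed

lemma derivation_top_form:
  "\<phi> UNIV (\<lambda>y. axis {Cgen, Dgen} 1) x =
     \<phi> UNIV (\<lambda>y. Cstar) x \<and>\<^sub>\<Lambda> Dstar + (- 1) ^ p *s (Cstar \<and>\<^sub>\<Lambda> \<phi> UNIV (\<lambda>y. Dstar) x)"
proof -
  have "section_homogeneous 1 (\<lambda>y::'k. Cstar)"
    by (auto simp: section_homogeneous_def axis_ext_component split: if_splits)
  from derivation_wedge[OF open_UNIV const_section const_section this, of Dstar]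
  show ?thesis by (simp add: Cstar_wedge_Dstar)
qed

text \<open>Summing the Leibniz rule over the four monomials \<open>1, \<theta>\<^sub>1, \<theta>\<^sub>2, \<theta>\<^sub>1\<theta>\<^sub>2\<close> shows that \<open>\<phi>\<close> is determined
by its values on \<open>x\<close>, \<open>\<theta>\<^sub>1\<close> and \<open>\<theta>\<^sub>2\<close> over the whole space.\<close>

lemma derivation_expansion:
  assumes U: "open U" and s: "s \<in> sections \<O> U" and x: "x \<in> U"
  defines "Z \<equiv> \<phi> UNIV (\<lambda>y. y *s ext_one) x"
  shows "\<phi> U s x =
      (sderiv s x $ {} *s Z) \<and>\<^sub>\<Lambda> ext_one
    + ((sderiv s x $ {Cgen} *s Z) \<and>\<^sub>\<Lambda> Cstar + s x $ {Cgen} *s \<phi> UNIV (\<lambda>y. Cstar) x)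
    + ((sderiv s x $ {Dgen} *s Z) \<and>\<^sub>\<Lambda> Dstar + s x $ {Dgen} *s \<phi> UNIV (\<lambda>y. Dstar) x)
    + ((sderiv s x $ {Cgen, Dgen} *s Z) \<and>\<^sub>\<Lambda> axis {Cgen, Dgen} 1
      + s x $ {Cgen, Dgen} *s (\<phi> UNIV (\<lambda>y. Cstar) x \<and>\<^sub>\<Lambda> Dstar
          + (- 1) ^ p *s (Cstar \<and>\<^sub>\<Lambda> \<phi> UNIV (\<lambda>y. Dstar) x)))"
proof -
  have sm: "smooth_on U (\<lambda>y. s y $ S)" for S using s U by (simp add: sections_iff)
  have mem: "(\<lambda>y. s y $ S *s restr U (\<lambda>y. v) y) \<in> sections \<O> U" for S and v :: "('k, odd_basis) ext"
    by (rule function_mult_section[OF U sm restr_section[OF open_UNIV U]]) (auto intro: smooth_on_const)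
  define part where "part S = (\<lambda>y. s y $ S *s restr U (\<lambda>y. axis S 1) y)" for S
  have "s = (\<lambda>y. ((part {} y + part {Cgen} y) + part {Dgen} y) + part {Cgen, Dgen} y)"
  proof
    fix y show "s y = ((part {} y + part {Cgen} y) + part {Dgen} y) + part {Cgen, Dgen} y"
      using s by (cases "y \<in> U") (auto simp: part_def restr_def ext_simps sections_def)
  qed
  then have "\<phi> U s x = \<phi> U (\<lambda>y. ((part {} y + part {Cgen} y) + part {Dgen} y) + part {Cgen, Dgen} y) x"
    by (rule arg_cong)
  moreover have part: "part S \<in> sections \<O> U" for S unfolding part_def by (rule mem)
  have "\<phi> U (\<lambda>y. ((part {} y + part {Cgen} y) + part {Dgen} y) + part {Cgen, Dgen} y) x =
      \<phi> U (part {}) x + \<phi> U (part {Cgen}) x + \<phi> U (part {Dgen}) x + \<phi> U (part {Cgen, Dgen}) x"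
    by (simp add: derivation_add[OF U] add_section[OF U] part)
  ultimately have "\<phi> U s x = \<phi> U (part {}) x + \<phi> U (part {Cgen}) x + \<phi> U (part {Dgen}) x
      + \<phi> U (part {Cgen, Dgen}) x"
    by (rule trans)
  then show ?thesis
    unfolding part_def derivation_const_multiple[OF U sm x] derivation_one derivation_top_form Z_def
    by (simp add: sderiv_def)
qed

end

end

text \<open>The vector field as a sheaf map. The value on arguments that are not sections is the one that
\<open>sheaf_endomorphism\<close> prescribes, so that superderivations can be equal to field maps.\<close>

definition field_map ::
    "'k::{real_normed_field,banach} sheaf_of_functions \<Rightarrow> 'k \<Rightarrow> 'k \<Rightarrow> 'k \<Rightarrow> 'k \<Rightarrow> 'k \<Rightarrow> 'k \<Rightarrow> 'k \<Rightarrow>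
      'k sheaf_map" where
  "field_map \<O> h a b p1 p2 w1 w2 U s =
     (if open U \<and> s \<in> sections \<O> U
      then restr U (\<lambda>x. field_value h a b p1 p2 w1 w2 (s x) (sderiv s x)) else (\<lambda>x. 0))"

lemma field_value_add:
  "field_value h a b p1 p2 w1 w2 (u + v) (u' + v') =
     field_value h a b p1 p2 w1 w2 u u' + field_value h a b p1 p2 w1 w2 v v'"
  by (simp add: ext_eq_iff field_value_components algebra_simps)

lemma field_value_scale:
  "field_value h a b p1 p2 w1 w2 (k *s u) (k *s u') = k *s field_value h a b p1 p2 w1 w2 u u'"
  by (simp add: ext_eq_iff field_value_components algebra_simps)

lemma field_value_wedge_even:
  "field_value h 0 0 0 0 0 0 (u \<and>\<^sub>\<Lambda> v) (u' \<and>\<^sub>\<Lambda> v + u \<and>\<^sub>\<Lambda> v') =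
     field_value h 0 0 0 0 0 0 u u' \<and>\<^sub>\<Lambda> v + u \<and>\<^sub>\<Lambda> field_value h 0 0 0 0 0 0 v v'"
  by (simp add: ext_eq_iff field_value_components wedge_components algebra_simps)

text \<open>Parity is assumed for \<open>u\<close> and \<open>u'\<close> alike, since the derivative of a homogeneous section is
homogeneous of the same parity. The sign comes from moving the odd field past \<open>u\<close>.\<close>

lemma field_value_wedge_odd:
  fixes u u' v v' :: "('k::field, odd_basis) ext"
  assumes "\<And>S. u $ S \<noteq> 0 \<or> u' $ S \<noteq> 0 \<Longrightarrow> even (card S + q)"
  shows "field_value 0 a b p1 p2 w1 w2 (u \<and>\<^sub>\<Lambda> v) (u' \<and>\<^sub>\<Lambda> v + u \<and>\<^sub>\<Lambda> v') =
     field_value 0 a b p1 p2 w1 w2 u u' \<and>\<^sub>\<Lambda> v +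
     (- 1) ^ q *s (u \<and>\<^sub>\<Lambda> field_value 0 a b p1 p2 w1 w2 v v')"
proof (cases "even q")
  case True
  then have "u $ {Cgen} = 0" "u' $ {Cgen} = 0" "u $ {Dgen} = 0" "u' $ {Dgen} = 0"
    using assms[of "{Cgen}"] assms[of "{Dgen}"] by auto
  then show ?thesis using True
    by (simp add: ext_eq_iff field_value_components wedge_components algebra_simps)
next
  case False
  then have "u $ {} = 0" "u' $ {} = 0" "u $ {Cgen, Dgen} = 0" "u' $ {Cgen, Dgen} = 0"
    using assms[of "{}"] assms[of "{Cgen, Dgen}"] by auto
  then show ?thesis using False
    by (simp add: ext_eq_iff field_value_components wedge_components algebra_simps)
qed

context smooth_function_sheaf
begin

lemma field_map_apply:
  "open U \<Longrightarrow> s \<in> sections \<O> U \<Longrightarrow> x \<in> U \<Longrightarrow>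
     field_map \<O> h a b p1 p2 w1 w2 U s x = field_value h a b p1 p2 w1 w2 (s x) (sderiv s x)"
  by (simp add: field_map_def restr_def)

lemma field_map_outside: "x \<notin> U \<Longrightarrow> field_map \<O> h a b p1 p2 w1 w2 U s x = 0"
  by (simp add: field_map_def restr_def)

lemma field_map_eqI:
  assumes "open U" "s \<in> sections \<O> U" "t \<in> sections \<O> U"
    and "\<And>x. x \<in> U \<Longrightarrow> field_value h a b p1 p2 w1 w2 (s x) (sderiv s x) = t x"
  shows "field_map \<O> h a b p1 p2 w1 w2 U s = t"
proof
  fix x show "field_map \<O> h a b p1 p2 w1 w2 U s x = t x"
    using assms by (cases "x \<in> U") (auto simp: field_map_apply field_map_outside sections_iff)
qed

lemma field_map_section:
  assumes U: "open U" and s: "s \<in> sections \<O> U"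
  shows "field_map \<O> h a b p1 p2 w1 w2 U s \<in> sections \<O> U"
proof -
  have sm: "smooth_on U (\<lambda>x. s x $ S)" "smooth_on U (\<lambda>x. sderiv s x $ S)" for S
    using s U sderiv_smooth by (auto simp: sections_iff)
  have "smooth_on U (\<lambda>x. field_value h a b p1 p2 w1 w2 (s x) (sderiv s x) $ S)" for S
    using odd_basis_set_cases[of S]
    by (elim disjE) (simp_all add: field_value_components smooth_on_add smooth_on_diff smooth_on_mult
        smooth_on_const sm U)
  from restr_section[OF U U order_refl this] show ?thesis using U s by (simp add: field_map_def)
qed

text \<open>The coefficients of the vector field are constant, so it commutes with \<open>\<partial>\<^sub>x\<close>.\<close>

lemma sderiv_field_map:
  assumes U: "open U" and s: "s \<in> sections \<O> U" and x: "x \<in> U"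
  shows "sderiv (field_map \<O> h a b p1 p2 w1 w2 U s) x =
    field_value h a b p1 p2 w1 w2 (sderiv s x) (sderiv (sderiv s) x)"
proof (rule sderiv_eqI)
  fix S
  have d: "((\<lambda>y. s y $ S) has_field_derivative sderiv s x $ S) (at x)" for S
    by (rule section_has_derivative[OF U s x])
  have d': "((\<lambda>y. sderiv s y $ S) has_field_derivative sderiv (sderiv s) x $ S) (at x)" for S
    using smooth_on_has_derivative[OF sderiv_smooth[OF U s] x, of S] by (simp add: sderiv_def[of "sderiv s"])
  show "((\<lambda>y. field_map \<O> h a b p1 p2 w1 w2 U s y $ S) has_field_derivative
      field_value h a b p1 p2 w1 w2 (sderiv s x) (sderiv (sderiv s) x) $ S) (at x)"
  proof (rule has_field_derivative_cong_open[OF U x])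
    show "field_map \<O> h a b p1 p2 w1 w2 U s y $ S =
        field_value h a b p1 p2 w1 w2 (s y) (sderiv s y) $ S" if "y \<in> U" for y
      by (simp add: field_map_apply U s that)
    show "((\<lambda>y. field_value h a b p1 p2 w1 w2 (s y) (sderiv s y) $ S) has_field_derivative
        field_value h a b p1 p2 w1 w2 (sderiv s x) (sderiv (sderiv s) x) $ S) (at x)"
      using odd_basis_set_cases[of S]
      by (elim disjE; simp only: field_value_components)
         (intro DERIV_add DERIV_diff DERIV_cmult d d')+
  qed
qed

lemma sderiv_add:
  assumes "open U" "s \<in> sections \<O> U" "t \<in> sections \<O> U" "x \<in> U"
  shows "sderiv (\<lambda>y. s y + t y) x = sderiv s x + sderiv t x"
  by (rule sderiv_eqI) (auto intro!: DERIV_add section_has_derivative[OF assms(1) _ assms(4)] assms)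

lemma sderiv_scale:
  assumes "open U" "s \<in> sections \<O> U" "x \<in> U"
  shows "sderiv (\<lambda>y. k *s s y) x = k *s sderiv s x"
  by (rule sderiv_eqI) (auto intro!: DERIV_cmult section_has_derivative assms)

lemma sderiv_restr:
  assumes "open V" "x \<in> V"
  shows "sderiv (restr V s) x = sderiv s x"
proof -
  have "deriv (\<lambda>y. restr V s y $ S) x = deriv (\<lambda>y. s y $ S) x" for S
  proof (rule deriv_cong_ev[OF _ refl])
    show "eventually (\<lambda>y. restr V s y $ S = s y $ S) (nhds x)"
      unfolding eventually_nhds using assms by (intro exI[of _ V]) (simp add: restr_def)
  qed
  then show ?thesis by (simp add: sderiv_def vec_eq_iff)
qed

lemma wedge_section:
  assumes "open U" "s \<in> sections \<O> U" "t \<in> sections \<O> U"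
  shows "(\<lambda>x. s x \<and>\<^sub>\<Lambda> t x) \<in> sections \<O> U"
proof -
  have "smooth_on U (\<lambda>x. (s x \<and>\<^sub>\<Lambda> t x) $ S)" for S
    using odd_basis_set_cases[of S] assms
    by (elim disjE) (simp_all add: wedge_components sections_iff smooth_on_add smooth_on_diff smooth_on_mult)
  moreover have "s x \<and>\<^sub>\<Lambda> t x = 0" if "x \<notin> U" for x
    using assms that by (simp add: ext_simps sections_iff)
  ultimately show ?thesis using assms by (simp add: sections_iff)
qed

lemma sderiv_wedge:
  assumes U: "open U" and s: "s \<in> sections \<O> U" and t: "t \<in> sections \<O> U" and x: "x \<in> U"
  shows "sderiv (\<lambda>y. s y \<and>\<^sub>\<Lambda> t y) x = sderiv s x \<and>\<^sub>\<Lambda> t x + s x \<and>\<^sub>\<Lambda> sderiv t x"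
proof (rule sderiv_eqI)
  fix S
  note [derivative_intros] = section_has_derivative[OF U s x] section_has_derivative[OF U t x]
  show "((\<lambda>y. (s y \<and>\<^sub>\<Lambda> t y) $ S) has_field_derivative (sderiv s x \<and>\<^sub>\<Lambda> t x + s x \<and>\<^sub>\<Lambda> sderiv t x) $ S) (at x)"
    using odd_basis_set_cases[of S]
    by (elim disjE; simp only: wedge_components vector_add_component)
       (auto intro!: derivative_eq_intros simp: algebra_simps)
qed

lemma section_homogeneous_sderiv:
  assumes "section_homogeneous q s" "sderiv s x $ S \<noteq> 0"
  shows "even (card S + q)"
proof (rule ccontr)
  assume "odd (card S + q)"
  then have "s y $ S = 0" for y using assms(1) by (auto simp: section_homogeneous_def)
  then show False using assms(2) by (simp add: sderiv_def)
qed

lemma sheaf_endomorphism_field_map: "sheaf_endomorphism \<O> (field_map \<O> h a b p1 p2 w1 w2)"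
  unfolding sheaf_endomorphism_def
proof (intro conjI allI impI ballI)
  fix U s t assume U: "open U" and s: "s \<in> sections \<O> U" and t: "t \<in> sections \<O> U"
  show "field_map \<O> h a b p1 p2 w1 w2 U (\<lambda>x. s x + t x) =
      (\<lambda>x. field_map \<O> h a b p1 p2 w1 w2 U s x + field_map \<O> h a b p1 p2 w1 w2 U t x)"
    by (rule field_map_eqI[OF U add_section[OF U s t] add_section[OF U]])
       (simp_all add: field_map_section U s t sderiv_add[OF U s t] field_value_add field_map_apply)
next
  fix U a' s assume U: "open U" and s: "s \<in> sections \<O> U"
  show "field_map \<O> h a b p1 p2 w1 w2 U (\<lambda>x. a' *s s x) = (\<lambda>x. a' *s field_map \<O> h a b p1 p2 w1 w2 U s x)"
    by (rule field_map_eqI[OF U function_mult_section[OF U smooth_on_const[OF U] s]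
          function_mult_section[OF U smooth_on_const[OF U]]])
       (simp_all add: field_map_section U s sderiv_scale[OF U s] field_value_scale field_map_apply)
next
  fix U V s assume U: "open U" and V: "open V" "V \<subseteq> U" and s: "s \<in> sections \<O> U"
  have r: "restr V t \<in> sections \<O> V" if "t \<in> sections \<O> U" for t
    using that U by (intro restr_section[OF U V]) (simp add: sections_iff)
  show "field_map \<O> h a b p1 p2 w1 w2 V (restr V s) = restr V (field_map \<O> h a b p1 p2 w1 w2 U s)"
  proof (rule field_map_eqI[OF V(1) r[OF s] r[OF field_map_section[OF U s]]])
    fix x assume x: "x \<in> V"
    then show "field_value h a b p1 p2 w1 w2 (restr V s x) (sderiv (restr V s) x) =
        restr V (field_map \<O> h a b p1 p2 w1 w2 U s) x"
      using V field_map_apply[OF U s, of x] by (auto simp: sderiv_restr) (auto simp: restr_def)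
  qed
qed (auto simp: field_map_section, simp_all add: field_map_def)

lemma superderivation_field_map_even:
  assumes "even p"
  shows "superderivation \<O> p (field_map \<O> h 0 0 0 0 0 0)"
  unfolding superderivation_def
proof (intro conjI allI impI ballI sheaf_endomorphism_field_map)
  fix U q s assume U: "open U" and s: "s \<in> sections \<O> U" and q: "section_homogeneous q s"
  show "section_homogeneous (p + q) (field_map \<O> h 0 0 0 0 0 0 U s)"
    unfolding section_homogeneous_def
  proof (intro allI impI)
    fix x S assume nz: "field_map \<O> h 0 0 0 0 0 0 U s x $ S \<noteq> 0"
    then have "x \<in> U" using field_map_outside by fastforce
    then have "sderiv s x $ S \<noteq> 0"
      using nz odd_basis_set_cases[of S] U s by (auto simp: field_map_apply field_value_components)
    then show "even (card S + (p + q))"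
      using section_homogeneous_sderiv[OF q] assms by simp
  qed
next
  fix U q s t assume U: "open U" and s: "s \<in> sections \<O> U" and t: "t \<in> sections \<O> U"
  show "field_map \<O> h 0 0 0 0 0 0 U (\<lambda>x. s x \<and>\<^sub>\<Lambda> t x) = (\<lambda>x. field_map \<O> h 0 0 0 0 0 0 U s x \<and>\<^sub>\<Lambda> t x +
      (- 1) ^ (p * q) *s (s x \<and>\<^sub>\<Lambda> field_map \<O> h 0 0 0 0 0 0 U t x))"
    using assms
    by (intro field_map_eqI U wedge_section s t add_section function_mult_section smooth_on_const field_map_section)
       (simp add: sderiv_wedge[OF U s t] field_value_wedge_even field_map_apply[OF U] s t)
qed

lemma superderivation_field_map_odd:
  assumes "odd p"
  shows "superderivation \<O> p (field_map \<O> 0 a b p1 p2 w1 w2)"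
  unfolding superderivation_def
proof (intro conjI allI impI ballI sheaf_endomorphism_field_map)
  fix U q s assume U: "open U" and s: "s \<in> sections \<O> U" and q: "section_homogeneous q s"
  show "section_homogeneous (p + q) (field_map \<O> 0 a b p1 p2 w1 w2 U s)"
    unfolding section_homogeneous_def
  proof (intro allI impI)
    fix x S assume nz: "field_map \<O> 0 a b p1 p2 w1 w2 U s x $ S \<noteq> 0"
    then have x: "x \<in> U" using field_map_outside by fastforce
    have par: "s x $ T = 0" "sderiv s x $ T = 0" if "odd (card T + q)" for T
      using section_homogeneous_sderiv[OF q] q that by (auto simp: section_homogeneous_def)
    show "even (card S + (p + q))"
    proof (rule ccontr)
      assume odd: "odd (card S + (p + q))"
      have "field_value 0 a b p1 p2 w1 w2 (s x) (sderiv s x) $ S = 0"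
        using odd_basis_set_cases[of S] odd assms
        by (elim disjE) (auto simp: field_value_components par)
      then show False using nz by (simp add: field_map_apply U s x)
    qed
  qed
next
  fix U q s t assume U: "open U" and s: "s \<in> sections \<O> U" and t: "t \<in> sections \<O> U"
    and q: "section_homogeneous q s"
  have sign: "(- 1 :: 'k) ^ (p * q) = (- 1) ^ q"
    using assms by (simp add: power_mult)
  have val: "field_value 0 a b p1 p2 w1 w2 (s x \<and>\<^sub>\<Lambda> t x) (sderiv s x \<and>\<^sub>\<Lambda> t x + s x \<and>\<^sub>\<Lambda> sderiv t x) =
     field_value 0 a b p1 p2 w1 w2 (s x) (sderiv s x) \<and>\<^sub>\<Lambda> t x +
     (- 1) ^ q *s (s x \<and>\<^sub>\<Lambda> field_value 0 a b p1 p2 w1 w2 (t x) (sderiv t x))" for x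
    by (rule field_value_wedge_odd)
       (use q section_homogeneous_sderiv[OF q] in \<open>auto simp: section_homogeneous_def\<close>)
  show "field_map \<O> 0 a b p1 p2 w1 w2 U (\<lambda>x. s x \<and>\<^sub>\<Lambda> t x) =
      (\<lambda>x. field_map \<O> 0 a b p1 p2 w1 w2 U s x \<and>\<^sub>\<Lambda> t x +
        (- 1) ^ (p * q) *s (s x \<and>\<^sub>\<Lambda> field_map \<O> 0 a b p1 p2 w1 w2 U t x))"
    unfolding sign
    by (intro field_map_eqI U wedge_section s t add_section function_mult_section smooth_on_const field_map_section)
       (simp add: sderiv_wedge[OF U s t] val field_map_apply[OF U] s t)
qed

end

section \<open>Invariant odd superderivations\<close>

lemma sl11_expansion: "X = X $ Hplus *s sl11_H + (X $ Odd Cgen *s sl11_C + X $ Odd Dgen *s sl11_D)"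
proof -
  have "X $ i = (X $ Hplus *s sl11_H + (X $ Odd Cgen *s sl11_C + X $ Odd Dgen *s sl11_D)) $ i" for i
  proof (cases i)
    case (Odd j)
    then show ?thesis by (cases j) (simp_all add: axis_def)
  qed (simp add: axis_def)
  then show ?thesis by (rule vec_eq_iff[THEN iffD2, OF allI])
qed

lemma sl11_homogeneous_basis:
  "sl11_homogeneous 0 sl11_H" "sl11_homogeneous 1 sl11_C" "sl11_homogeneous 1 sl11_D"
  by (simp_all add: sl11_homogeneous_def axis_def)

lemma sl11_bracket_basis:
  "sl11_bracket sl11_C sl11_C = 0" "sl11_bracket sl11_D sl11_D = 0"
  "sl11_bracket sl11_C sl11_D = sl11_H"
  "sl11_bracket sl11_H X = 0"
  by (simp_all add: sl11_bracket_def axis_def vec_eq_iff)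

context smooth_function_sheaf
begin

lemma even_superderivation_eq_field_map:
  assumes \<phi>: "superderivation \<O> 0 \<phi>"
    and ident: "\<phi> UNIV (\<lambda>y. y *s ext_one) = (\<lambda>y. ext_one)"
    and gens: "\<phi> UNIV (\<lambda>y. Cstar) = (\<lambda>y. 0)" "\<phi> UNIV (\<lambda>y. Dstar) = (\<lambda>y. 0)"
  shows "\<phi> = field_map \<O> 1 0 0 0 0 0 0"
proof (intro ext)
  fix U s x
  show "\<phi> U s x = field_map \<O> 1 0 0 0 0 0 0 U s x"
  proof (cases "open U \<and> s \<in> sections \<O> U")
    case True
    then have U: "open U" and s: "s \<in> sections \<O> U" by auto
    show ?thesis
    proof (cases "x \<in> U")
      case x: True
      show ?thesis
        unfolding field_map_apply[OF U s x] derivation_expansion[OF \<phi> U s x] ident gens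
        by (simp add: ext_simps field_value_components)
    next
      case False
      then show ?thesis
        using derivation_section[OF \<phi> U s] U by (simp add: field_map_outside sections_iff)
    qed
  next
    case False
    then show ?thesis
      using derivation_junk[OF \<phi> False] by (auto simp: field_map_def)
  qed
qed

text \<open>The function \<open>exp\<close> can replace the coordinate \<open>x\<close> as a test function because its derivative has no
zeros: dividing by \<open>exp\<close> recovers the value on \<open>x\<close>.\<close>

lemma odd_superderivation_eq_field_map:
  assumes \<phi>: "superderivation \<O> 1 \<phi>"
    and exp: "\<phi> UNIV (\<lambda>y. exp y *s ext_one) = (\<lambda>y. (a * exp y) *s Cstar + (b * exp y) *s Dstar)"
    and C: "\<phi> UNIV (\<lambda>y. Cstar) = (\<lambda>y. p1 *s ext_one + w1 *s (Cstar \<and>\<^sub>\<Lambda> Dstar))"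
    and D: "\<phi> UNIV (\<lambda>y. Dstar) = (\<lambda>y. p2 *s ext_one + w2 *s (Cstar \<and>\<^sub>\<Lambda> Dstar))"
  shows "\<phi> = field_map \<O> 0 a b p1 p2 w1 w2"
proof (intro ext)
  have Z: "\<phi> UNIV (\<lambda>y. y *s ext_one) x = a *s Cstar + b *s Dstar" for x
  proof -
    have "exp x *s (a *s Cstar + b *s Dstar) = exp x *s \<phi> UNIV (\<lambda>y. y *s ext_one) x"
      using derivation_function[OF \<phi> open_UNIV smooth_on_exp[OF open_UNIV], of x]
        DERIV_imp_deriv[OF DERIV_exp, of x]
      unfolding restr_def by (simp add: exp vec_eq_iff algebra_simps)
    then show ?thesis by (simp only: vector_mul_lcancel exp_not_eq_zero simp_thms)
  qed
  fix U s x
  show "\<phi> U s x = field_map \<O> 0 a b p1 p2 w1 w2 U s x"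
  proof (cases "open U \<and> s \<in> sections \<O> U")
    case True
    then have U: "open U" and s: "s \<in> sections \<O> U" by auto
    show ?thesis
    proof (cases "x \<in> U")
      case x: True
      show ?thesis
        unfolding field_map_apply[OF U s x] derivation_expansion[OF \<phi> U s x] Z C D Cstar_wedge_Dstar
        by (simp add: ext_simps field_value_components algebra_simps)
    next
      case False
      then show ?thesis
        using derivation_section[OF \<phi> U s] U by (simp add: field_map_outside sections_iff)
    qed
  next
    case False
    then show ?thesis
      using derivation_junk[OF \<phi> False] by (auto simp: field_map_def)
  qed
qed

lemma derivative_eq_self_imp_exp:
  fixes g :: "'k \<Rightarrow> 'k"
  assumes "\<And>x. (g has_field_derivative g x) (at x)"
  shows "\<exists>k. \<forall>x. g x = k * exp x"
proof -
  \<comment> \<open>The quotient of \<open>g\<close> by \<open>exp\<close> has derivative zero.\<close>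
  have "((\<lambda>x. g x * exp (- x)) has_field_derivative 0) (at x within UNIV)" for x
    by (auto intro!: derivative_eq_intros assms)
  from has_field_derivative_zero_constant[OF convex_UNIV this]
  obtain k where k: "\<And>x. g x * exp (- x) = k" by auto
  have "g x = k * exp x" for x
  proof -
    have "g x * exp (- x) * exp x = g x"
      using exp_minus_inverse[of x] by (simp add: mult_ac)
    then show ?thesis using k[of x] by simp
  qed
  then show ?thesis by blast
qed

lemma sderiv_zero_imp_const:
  assumes s: "s \<in> sections \<O> UNIV" and 0: "\<And>x. sderiv s x = 0"
  shows "\<exists>v. s = (\<lambda>x. v)"
proof -
  have "\<exists>k. \<forall>x\<in>UNIV. s x $ S = k" for S
    by (rule has_field_derivative_zero_constant[OF convex_UNIV])
       (use section_has_derivative[OF open_UNIV s] 0 in auto)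
  then have "s x $ S = s 0 $ S" for x S by (metis UNIV_I)
  then have "s = (\<lambda>x. s 0)" by (intro ext) (simp add: vec_eq_iff)
  then show ?thesis by blast
qed

text \<open>Commuting with \<open>\<partial>\<^sub>x\<close> makes all coefficients constant. The image of \<open>exp\<close> is its own derivative,
hence a constant multiple of \<open>exp\<close>; the images of \<open>\<theta>\<^sub>1\<close> and \<open>\<theta>\<^sub>2\<close> have derivative zero, hence are
constant. Parity removes the components \<open>1\<close> and \<open>\<theta>\<^sub>1\<theta>\<^sub>2\<close> of the first and the components
\<open>\<theta>\<^sub>1\<close> and \<open>\<theta>\<^sub>2\<close> of the others.\<close>

lemma invariant_odd_superderivation_eq_field_map:
  assumes \<phi>: "superderivation \<O> 1 \<phi>"
    and inv: "\<And>s. s \<in> sections \<O> UNIV \<Longrightarrow> sderiv s \<in> sections \<O> UNIV \<Longrightarrow>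
      sderiv (\<phi> UNIV s) = \<phi> UNIV (sderiv s)"
  shows "\<exists>a b p1 p2 w1 w2. \<phi> = field_map \<O> 0 a b p1 p2 w1 w2"
proof -
  define G where "G = \<phi> UNIV (\<lambda>y. exp y *s ext_one)"
  have G: "G \<in> sections \<O> UNIV" "sderiv G = G"
    unfolding G_def using inv[of "\<lambda>y. exp y *s ext_one"]
    by (simp_all add: derivation_section[OF \<phi>] exp_section sderiv_exp)
  have "\<exists>k. \<forall>x. G x $ S = k * exp x" for S
    by (rule derivative_eq_self_imp_exp)
       (use section_has_derivative[OF open_UNIV G(1), of _ S] G(2) in auto)
  then obtain k where k: "\<And>S x. G x $ S = k S * exp x" by metis
  have "section_homogeneous (1 + 0) G"
    unfolding G_def
    by (rule derivation_parity[OF \<phi> open_UNIV exp_section])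
       (auto simp: section_homogeneous_def axis_ext_component split: if_splits)
  then have "G x $ S \<noteq> 0 \<Longrightarrow> even (card S + (1 + 0))" for x S
    by (simp add: section_homogeneous_def)
  from this[of _ "{}"] this[of _ "{Cgen, Dgen}"]
  have "G x $ {} = 0" "G x $ {Cgen, Dgen} = 0" for x
    by auto
  then have exp: "G = (\<lambda>y. (k {Cgen} * exp y) *s Cstar + (k {Dgen} * exp y) *s Dstar)"
    by (intro ext) (simp add: ext_simps k)
  have gen: "\<exists>c w. \<phi> UNIV (\<lambda>y. ext_gen i) = (\<lambda>y. c *s ext_one + w *s (Cstar \<and>\<^sub>\<Lambda> Dstar))" for i
  proof -
    define A where "A = \<phi> UNIV (\<lambda>y. ext_gen i)"
    have zero: "sderiv (\<lambda>y::'k. v) = (\<lambda>y. 0)" for v :: "('k, odd_basis) ext" by auto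
    have A: "A \<in> sections \<O> UNIV" "sderiv A = (\<lambda>y. 0)"
      unfolding A_def using inv[of "\<lambda>y. ext_gen i"]
      by (simp_all add: derivation_section[OF \<phi>] const_section zero
          derivation_zero[OF \<phi> open_UNIV const_section])
    then obtain v where v: "A = (\<lambda>x. v)" using sderiv_zero_imp_const[OF A(1)] by auto
    have "section_homogeneous (1 + 1) A"
      unfolding A_def
      by (rule derivation_parity[OF \<phi> open_UNIV const_section])
         (auto simp: section_homogeneous_def axis_ext_component split: if_splits)
    then have "v $ {Cgen} = 0" "v $ {Dgen} = 0"
      by (auto simp: section_homogeneous_def v)
    then have "A = (\<lambda>y. v $ {} *s ext_one + v $ {Cgen, Dgen} *s (Cstar \<and>\<^sub>\<Lambda> Dstar))"
      by (simp add: v fun_eq_iff ext_simps)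
    then show ?thesis unfolding A_def by blast
  qed
  obtain p1 w1 where "\<phi> UNIV (\<lambda>y. Cstar) = (\<lambda>y. p1 *s ext_one + w1 *s (Cstar \<and>\<^sub>\<Lambda> Dstar))"
    using gen by blast
  moreover obtain p2 w2 where "\<phi> UNIV (\<lambda>y. Dstar) = (\<lambda>y. p2 *s ext_one + w2 *s (Cstar \<and>\<^sub>\<Lambda> Dstar))"
    using gen by blast
  ultimately show ?thesis
    using odd_superderivation_eq_field_map[OF \<phi> exp[unfolded G_def]] by blast
qed

lemma field_map_exp:
  "field_map \<O> 0 a b p1 p2 w1 w2 UNIV (\<lambda>x. exp x *s ext_one) =
     (\<lambda>x. (a * exp x) *s Cstar + (b * exp x) *s Dstar)"
  by (intro ext)
     (simp add: field_map_apply[OF open_UNIV exp_section] sderiv_exp ext_simps field_value_components)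

lemma field_map_const:
  "field_map \<O> h a b p1 p2 w1 w2 UNIV (\<lambda>x. v) = (\<lambda>x. field_value h a b p1 p2 w1 w2 v 0)"
  by (intro ext) (simp add: field_map_apply[OF open_UNIV const_section])

lemma field_map_gens:
  "field_map \<O> 0 a b p1 p2 w1 w2 UNIV (\<lambda>x. Cstar) = (\<lambda>x. p1 *s ext_one + w1 *s (Cstar \<and>\<^sub>\<Lambda> Dstar))"
  "field_map \<O> 0 a b p1 p2 w1 w2 UNIV (\<lambda>x. Dstar) = (\<lambda>x. p2 *s ext_one + w2 *s (Cstar \<and>\<^sub>\<Lambda> Dstar))"
  by (simp_all add: field_map_const fun_eq_iff ext_simps field_value_components)

lemma exp_combination_eq_iff:
  "((\<lambda>x::'k. (a * exp x) *s Cstar + (b * exp x) *s Dstar) =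
     (\<lambda>x. (a' * exp x) *s Cstar + (b' * exp x) *s Dstar)) \<longleftrightarrow> a = a' \<and> b = b'"
  by (auto simp: fun_eq_iff ext_simps dest: spec[of _ 0])

lemma const_combination_eq_iff:
  "((\<lambda>x::'k. p *s ext_one + w *s (Cstar \<and>\<^sub>\<Lambda> Dstar)) = (\<lambda>x. p' *s ext_one + w' *s (Cstar \<and>\<^sub>\<Lambda> Dstar)))
     \<longleftrightarrow> (p :: 'k) = p' \<and> w = w'"
  by (auto simp: fun_eq_iff ext_simps)

text \<open>The parameters \<open>c\<close> and \<open>d\<close> express that \<open>(a, b)\<close> is a multiple of \<open>(p2, - p1)\<close>, and likewise for
the other field; they need not exist, or be unique, until more is known about the coefficients.\<close>

lemma sl11_parameters_iff:
  assumes "\<rho> sl11_C = field_map \<O> 0 a b p1 p2 w1 w2" "\<rho> sl11_D = field_map \<O> 0 a' b' q1 q2 v1 v2"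
  shows "sl11_parameters \<rho> (c1, c2, d1, d2, c, d) \<longleftrightarrow>
    c1 = p1 \<and> c2 = p2 \<and> d1 = q1 \<and> d2 = q2 \<and>
    a = p2 * c \<and> b = - p1 * c \<and> a' = q2 * d \<and> b' = - q1 * d"
  unfolding sl11_parameters_def sl11_constants_def assms field_map_exp field_map_gens case_prod_conv
    exp_combination_eq_iff const_combination_eq_iff prod.inject
  by auto

lemma field_map_compose:
  assumes "open U" "s \<in> sections \<O> U" "x \<in> U"
  shows "field_map \<O> h a b p1 p2 w1 w2 U (field_map \<O> h' a' b' q1 q2 v1 v2 U s) x =
    field_value h a b p1 p2 w1 w2 (field_value h' a' b' q1 q2 v1 v2 (s x) (sderiv s x))
      (field_value h' a' b' q1 q2 v1 v2 (sderiv s x) (sderiv (sderiv s) x))"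
  by (simp add: field_map_apply field_map_section sderiv_field_map assms)

end

section \<open>The defining relations in terms of coefficients\<close>

text \<open>Without the terms \<open>w1, w2\<close>, the supercommutator of two odd fields is a constant multiple of
\<open>\<partial>\<^sub>x\<close>; the multiple pairs the \<open>\<partial>\<^sub>x\<close>-part of each field with the \<open>\<partial>\<^sub>\<theta>\<close>-part of the other.\<close>

lemma supercommutator_odd_fields:
  "field_value 0 a b p1 p2 0 0 (field_value 0 a' b' q1 q2 0 0 v v') (field_value 0 a' b' q1 q2 0 0 v' v'') +
   field_value 0 a' b' q1 q2 0 0 (field_value 0 a b p1 p2 0 0 v v') (field_value 0 a b p1 p2 0 0 v' v'') =
   (a * q1 + b * q2 + a' * p1 + b' * p2) *s v'"
  by (simp add: ext_eq_iff field_value_components algebra_simps)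

lemma even_field_value: "field_value h 0 0 0 0 0 0 v v' = h *s v'"
  by (simp add: ext_eq_iff field_value_components)

lemma field_map_coefficients_add:
  "field_map \<O> (h + h') (a + a') (b + b') (p1 + q1) (p2 + q2) (w1 + v1) (w2 + v2) U s x =
     field_map \<O> h a b p1 p2 w1 w2 U s x + field_map \<O> h' a' b' q1 q2 v1 v2 U s x"
  by (simp add: field_map_def restr_def ext_eq_iff field_value_components algebra_simps)

lemma field_map_coefficients_scale:
  "field_map \<O> (k * h) (k * a) (k * b) (k * p1) (k * p2) (k * w1) (k * w2) U s x =
     k *s field_map \<O> h a b p1 p2 w1 w2 U s x"
  by (simp add: field_map_def restr_def ext_eq_iff field_value_components algebra_simps)

context smooth_function_sheaf
begin

text \<open>The relations come from evaluating the supercommutator at \<open>0\<close>, on \<open>exp\<close> for the first one and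
on \<open>\<theta>\<^sub>1\<close>, \<open>\<theta>\<^sub>2\<close> for the others. Taking both fields equal gives the relations from \<open>[C, C] = 0\<close>.\<close>

lemma anticommutator_relations:
  assumes anti: "\<And>s. s \<in> sections \<O> UNIV \<Longrightarrow>
      field_map \<O> 0 a b p1 p2 w1 w2 UNIV (field_map \<O> 0 a' b' q1 q2 v1 v2 UNIV s) 0 +
      field_map \<O> 0 a' b' q1 q2 v1 v2 UNIV (field_map \<O> 0 a b p1 p2 w1 w2 UNIV s) 0 =
      k *s sderiv s 0"
  shows "a * q1 + b * q2 + a' * p1 + b' * p2 = k"
    and "p1 * v1 + q1 * w1 = 0" "p1 * v2 + q1 * w2 = 0"
    and "p2 * v1 + q2 * w1 = 0" "p2 * v2 + q2 * w2 = 0"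
proof -
  let ?P = "field_value 0 a b p1 p2 w1 w2" and ?Q = "field_value 0 a' b' q1 q2 v1 v2"
  have "?P (?Q ext_one ext_one) (?Q ext_one ext_one) + ?Q (?P ext_one ext_one) (?P ext_one ext_one) =
      k *s ext_one"
    using anti[OF exp_section[of ext_one]]
    by (simp add: field_map_compose[OF open_UNIV exp_section] sderiv_exp)
  then show "a * q1 + b * q2 + a' * p1 + b' * p2 = k"
    by (simp add: ext_simps field_value_components algebra_simps)
  have gen: "?P (?Q (ext_gen i) 0) (?Q 0 0) + ?Q (?P (ext_gen i) 0) (?P 0 0) = 0" for i
  proof -
    have "sderiv (\<lambda>y::'k. v) = (\<lambda>y. 0)" for v :: "('k, odd_basis) ext" by auto
    then show ?thesis
      using anti[OF const_section[of "ext_gen i"]]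
      by (simp add: field_map_compose[OF open_UNIV const_section])
  qed
  show "p1 * v1 + q1 * w1 = 0" "p2 * v1 + q2 * w1 = 0"
    using gen[of Cgen] by (simp_all add: ext_simps field_value_components neg_eq_iff_add_eq_0 algebra_simps)
  show "p1 * v2 + q1 * w2 = 0" "p2 * v2 + q2 * w2 = 0"
    using gen[of Dgen] by (simp_all add: ext_simps field_value_components neg_eq_iff_add_eq_0 algebra_simps)
qed

text \<open>This is where the condition on invariants enters. If the first field had no \<open>\<partial>\<^sub>\<theta>\<close>-part, the
relation \<open>[C, D] = H\<close> would force \<open>(q1, q2) \<noteq> 0\<close>, the other relations would then make all the
\<open>w\<close>- and \<open>v\<close>-coefficients zero, and \<open>q2 \<theta>\<^sub>1 - q1 \<theta>\<^sub>2\<close> would be an invariant that is not a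
multiple of \<open>1\<close>.\<close>

lemma odd_field_nonzero_on_generators:
  fixes a b p1 p2 w1 w2 a' b' q1 q2 v1 v2 :: 'k
  assumes mixed: "a * q1 + b * q2 + a' * p1 + b' * p2 = 1"
      "p1 * v1 + q1 * w1 = 0" "p1 * v2 + q1 * w2 = 0" "p2 * v1 + q2 * w1 = 0" "p2 * v2 + q2 * w2 = 0"
    and square: "q1 * v1 = 0" "q1 * v2 = 0" "q2 * v1 = 0" "q2 * v2 = 0"
    and invariants: "\<And>v. field_value 0 a b p1 p2 w1 w2 v 0 = 0 \<Longrightarrow>
      field_value 0 a' b' q1 q2 v1 v2 v 0 = 0 \<Longrightarrow> \<exists>k. v = k *s ext_one"
  shows "p1 \<noteq> 0 \<or> p2 \<noteq> 0"
proof (rule ccontr)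
  assume "\<not> (p1 \<noteq> 0 \<or> p2 \<noteq> 0)"
  then have p: "p1 = 0" "p2 = 0" by auto
  then have q: "q1 \<noteq> 0 \<or> q2 \<noteq> 0" using mixed(1) by auto
  then have "v1 = 0" "v2 = 0" "w1 = 0" "w2 = 0" using square mixed p by auto
  then have "\<exists>k. q2 *s Cstar + (- q1) *s Dstar = k *s ext_one"
    using p by (intro invariants) (simp_all add: ext_simps field_value_components)
  then show False using q by (auto simp: ext_simps)
qed

text \<open>Every structure is given by constant-coefficient fields. Once \<open>(p1, p2)\<close> and \<open>(q1, q2)\<close> are known
to be nonzero, the relations from \<open>[C, C] = 0\<close> and \<open>[D, D] = 0\<close> eliminate the coefficients of
\<open>\<theta>\<^sub>1\<theta>\<^sub>2 \<partial>\<^sub>1\<close> and \<open>\<theta>\<^sub>1\<theta>\<^sub>2 \<partial>\<^sub>2\<close>, and only the pairing relations listed last remain.\<close>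

lemma RTLSG_normal_form:
  assumes \<rho>: "sl11_RTLSG \<O> \<rho>"
  obtains a b p1 p2 a' b' q1 q2 where
    "\<rho> sl11_H = field_map \<O> 1 0 0 0 0 0 0"
    "\<rho> sl11_C = field_map \<O> 0 a b p1 p2 0 0"
    "\<rho> sl11_D = field_map \<O> 0 a' b' q1 q2 0 0"
    "p1 \<noteq> 0 \<or> p2 \<noteq> 0" "q1 \<noteq> 0 \<or> q2 \<noteq> 0"
    "a * p1 + b * p2 = 0" "a' * q1 + b' * q2 = 0"
    "a * q1 + b * q2 + a' * p1 + b' * p2 = 1"
proof -
  have rep: "sl11_representation \<O> \<rho>"
    and fun_clause: "\<And>X U f. sl11_homogeneous 0 X \<Longrightarrow> open U \<Longrightarrow> f \<in> \<O> U \<Longrightarrow>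
        \<rho> X U (restr U (\<lambda>x. f x *s ext_one)) = restr U (\<lambda>x. (X $ Hplus * deriv f x) *s ext_one)"
    and gen_clause: "\<And>X U i. sl11_homogeneous 0 X \<Longrightarrow> open U \<Longrightarrow>
        \<rho> X U (restr U (\<lambda>x. ext_gen i)) =
          restr U (\<lambda>x. \<Sum>j\<in>UNIV. (sl11_bracket (axis (Odd j) 1) X $ Odd i) *s ext_gen j)"
    and inv_clause: "\<And>s. s \<in> sections \<O> UNIV \<Longrightarrow> (\<And>X. \<rho> X UNIV s = (\<lambda>x. 0)) \<Longrightarrow>
        \<exists>k. s = (\<lambda>x. k *s ext_one)"
    using \<rho> by (simp_all add: sl11_RTLSG_def)
  have add: "\<And>X Y U s. \<rho> (X + Y) U s = (\<lambda>x. \<rho> X U s x + \<rho> Y U s x)"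
    and scale: "\<And>a X U s. \<rho> (a *s X) U s = (\<lambda>x. a *s \<rho> X U s x)"
    and der: "\<And>p X. sl11_homogeneous p X \<Longrightarrow> superderivation \<O> p (\<rho> X)"
    and bracket: "\<And>p q X Y U s. sl11_homogeneous p X \<Longrightarrow> sl11_homogeneous q Y \<Longrightarrow> open U \<Longrightarrow>
        s \<in> sections \<O> U \<Longrightarrow> \<rho> (sl11_bracket X Y) U s =
          (\<lambda>x. \<rho> X U (\<rho> Y U s) x - (- 1) ^ (p * q) *s \<rho> Y U (\<rho> X U s) x)"
    using rep by (simp_all add: sl11_representation_def)
  note hom = sl11_homogeneous_basis
  have zero: "\<rho> 0 U s = (\<lambda>x. 0)" for U s
    using scale[of 0 0 U s] by simp
  have H: "\<rho> sl11_H = field_map \<O> 1 0 0 0 0 0 0"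
  proof (rule even_superderivation_eq_field_map[OF der[OF hom(1)]])
    show "\<rho> sl11_H UNIV (\<lambda>y. y *s ext_one) = (\<lambda>y. ext_one)"
      using fun_clause[OF hom(1) open_UNIV, of "\<lambda>y. y"]
      by (simp add: mem_iff_smooth_on smooth_on_ident restr_def axis_def)
    have "\<rho> sl11_H UNIV (\<lambda>y. ext_gen i) = (\<lambda>y. 0)" for i
      using gen_clause[OF hom(1) open_UNIV, of i]
      by (simp add: restr_def sl11_bracket_def axis_def)
    then show "\<rho> sl11_H UNIV (\<lambda>y. Cstar) = (\<lambda>y. 0)" "\<rho> sl11_H UNIV (\<lambda>y. Dstar) = (\<lambda>y. 0)"
      by blast+
  qed
  have Hval: "\<rho> sl11_H UNIV s = sderiv s" if "s \<in> sections \<O> UNIV" for s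
    unfolding H by (intro ext) (simp add: field_map_apply that even_field_value)
  have normal: "\<exists>a b p1 p2 w1 w2. \<rho> X = field_map \<O> 0 a b p1 p2 w1 w2"
    if X: "sl11_homogeneous 1 X" for X
  proof (rule invariant_odd_superderivation_eq_field_map[OF der[OF X]])
    fix s assume s: "s \<in> sections \<O> UNIV"
    have "(\<lambda>x. 0) = (\<lambda>x. \<rho> sl11_H UNIV (\<rho> X UNIV s) x - \<rho> X UNIV (\<rho> sl11_H UNIV s) x)"
      using bracket[OF hom(1) X open_UNIV s] by (simp add: sl11_bracket_basis zero)
    then have "\<rho> sl11_H UNIV (\<rho> X UNIV s) = \<rho> X UNIV (\<rho> sl11_H UNIV s)"
      by (simp add: fun_eq_iff)
    then show "sderiv (\<rho> X UNIV s) = \<rho> X UNIV (sderiv s)"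
      using Hval s derivation_section[OF der[OF X] open_UNIV s] by simp
  qed
  obtain a b p1 p2 w1 w2 where C: "\<rho> sl11_C = field_map \<O> 0 a b p1 p2 w1 w2"
    using normal[OF hom(2)] by blast
  obtain a' b' q1 q2 v1 v2 where D: "\<rho> sl11_D = field_map \<O> 0 a' b' q1 q2 v1 v2"
    using normal[OF hom(3)] by blast
  \<comment> \<open>For odd arguments the bracket relation reads \<open>[X, Y] = X Y + Y X\<close>.\<close>
  have CC: "field_map \<O> 0 a b p1 p2 w1 w2 UNIV (field_map \<O> 0 a b p1 p2 w1 w2 UNIV s) 0 +
      field_map \<O> 0 a b p1 p2 w1 w2 UNIV (field_map \<O> 0 a b p1 p2 w1 w2 UNIV s) 0 = 0 *s sderiv s 0"
    if "s \<in> sections \<O> UNIV" for s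
    using fun_cong[OF bracket[OF hom(2) hom(2) open_UNIV that], of 0]
    by (simp add: sl11_bracket_basis zero C)
  have DD: "field_map \<O> 0 a' b' q1 q2 v1 v2 UNIV (field_map \<O> 0 a' b' q1 q2 v1 v2 UNIV s) 0 +
      field_map \<O> 0 a' b' q1 q2 v1 v2 UNIV (field_map \<O> 0 a' b' q1 q2 v1 v2 UNIV s) 0 = 0 *s sderiv s 0"
    if "s \<in> sections \<O> UNIV" for s
    using fun_cong[OF bracket[OF hom(3) hom(3) open_UNIV that], of 0]
    by (simp add: sl11_bracket_basis zero D)
  have CD: "field_map \<O> 0 a b p1 p2 w1 w2 UNIV (field_map \<O> 0 a' b' q1 q2 v1 v2 UNIV s) 0 +
      field_map \<O> 0 a' b' q1 q2 v1 v2 UNIV (field_map \<O> 0 a b p1 p2 w1 w2 UNIV s) 0 = 1 *s sderiv s 0"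
    if "s \<in> sections \<O> UNIV" for s
    using fun_cong[OF bracket[OF hom(2) hom(3) open_UNIV that], of 0]
    by (simp add: sl11_bracket_basis Hval that C D)
  note cc = anticommutator_relations[OF CC] and dd = anticommutator_relations[OF DD]
    and cd = anticommutator_relations[OF CD]
  have double: "z = 0" if "z + z = 0" for z :: 'k
    using that by (simp flip: mult_2)
  have cc': "p1 * w1 = 0" "p1 * w2 = 0" "p2 * w1 = 0" "p2 * w2 = 0" "a * p1 + b * p2 = 0"
    by (rule double, use cc in \<open>simp only: add.assoc\<close>)+
  have dd': "q1 * v1 = 0" "q1 * v2 = 0" "q2 * v1 = 0" "q2 * v2 = 0" "a' * q1 + b' * q2 = 0"
    by (rule double, use dd in \<open>simp only: add.assoc\<close>)+
  have invariants: "\<exists>k. v = k *s ext_one"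
    if "field_value 0 a b p1 p2 w1 w2 v 0 = 0" "field_value 0 a' b' q1 q2 v1 v2 v 0 = 0" for v
  proof -
    have basis: "\<rho> sl11_H UNIV (\<lambda>x. v) = (\<lambda>x. 0)" "\<rho> sl11_C UNIV (\<lambda>x. v) = (\<lambda>x. 0)"
      "\<rho> sl11_D UNIV (\<lambda>x. v) = (\<lambda>x. 0)"
      by (simp_all add: H C D field_map_const that even_field_value)
    have "\<rho> X UNIV (\<lambda>x. v) = (\<lambda>x. 0)" for X
      by (subst sl11_expansion[of X]) (simp add: add scale basis)
    then obtain k where "(\<lambda>x::'k. v) = (\<lambda>x. k *s ext_one)"
      using inv_clause[OF const_section] by blast
    then show ?thesis by (metis (no_types))
  qed
  have p: "p1 \<noteq> 0 \<or> p2 \<noteq> 0"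
    by (rule odd_field_nonzero_on_generators[OF cd dd'(1-4) invariants])
  \<comment> \<open>The same statement with the roles of \<open>C\<close> and \<open>D\<close> exchanged.\<close>
  have q: "q1 \<noteq> 0 \<or> q2 \<noteq> 0"
    by (rule odd_field_nonzero_on_generators[of a' p1 b' p2 a q1 b q2 w1 v1 w2 v2])
       (use cd cc' invariants in \<open>simp_all add: algebra_simps\<close>)
  have "w1 = 0" "w2 = 0" "v1 = 0" "v2 = 0"
    using cc' dd' p q by auto
  then show ?thesis
    using that[OF H, of a b p1 p2 a' b' q1 q2] C D p q cc'(5) dd'(5) cd(1) by simp
qed

end

text \<open>In the plane, the vectors orthogonal to \<open>(p1, p2) \<noteq> 0\<close> form the line through \<open>(p2, - p1)\<close>. This is
why \<open>c\<close> and \<open>d\<close> exist and are unique.\<close>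

lemma orthogonal_pair_unique_multiple:
  fixes a b p1 p2 :: "'k::field"
  assumes "p1 \<noteq> 0 \<or> p2 \<noteq> 0" "a * p1 + b * p2 = 0"
  shows "\<exists>!c. a = p2 * c \<and> b = - p1 * c"
proof (cases "p1 = 0")
  case True
  then show ?thesis using assms by (intro ex1I[of _ "a / p2"]) auto
next
  case False
  have "a = - (b * p2) / p1" using assms(2) False by (simp add: field_simps eq_neg_iff_add_eq_0)
  then show ?thesis using False by (intro ex1I[of _ "- b / p1"]) auto
qed

lemma sl11_condition_iff:
  "sl11_condition (c1, c2, d1, d2, c, d) \<longleftrightarrow> (c1 * d2 - c2 * d1) * (d - c) = 1"
  by (simp add: sl11_condition_def det_2)

section \<open>The structure with given parameters\<close>

text \<open>The linear extension of \<open>H = \<partial>\<^sub>x\<close>, \<open>C = c (c2 \<theta>\<^sub>1 - c1 \<theta>\<^sub>2) \<partial>\<^sub>x + c1 \<partial>\<^sub>1 + c2 \<partial>\<^sub>2\<close> and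
\<open>D = d (d2 \<theta>\<^sub>1 - d1 \<theta>\<^sub>2) \<partial>\<^sub>x + d1 \<partial>\<^sub>1 + d2 \<partial>\<^sub>2\<close>.\<close>

definition sl11_model ::
    "'k::{real_normed_field,banach} sheaf_of_functions \<Rightarrow> 'k \<Rightarrow> 'k \<Rightarrow> 'k \<Rightarrow> 'k \<Rightarrow> 'k \<Rightarrow> 'k \<Rightarrow>
      'k sl11 \<Rightarrow> 'k sheaf_map" where
  "sl11_model \<O> c1 c2 d1 d2 c d X =
     field_map \<O> (X $ Hplus)
       (X $ Odd Cgen * (c2 * c) + X $ Odd Dgen * (d2 * d))
       (X $ Odd Cgen * (- c1 * c) + X $ Odd Dgen * (- d1 * d))
       (X $ Odd Cgen * c1 + X $ Odd Dgen * d1)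
       (X $ Odd Cgen * c2 + X $ Odd Dgen * d2) 0 0"

context smooth_function_sheaf
begin

lemma sl11_model_basis:
  "sl11_model \<O> c1 c2 d1 d2 c d sl11_H = field_map \<O> 1 0 0 0 0 0 0"
  "sl11_model \<O> c1 c2 d1 d2 c d sl11_C = field_map \<O> 0 (c2 * c) (- c1 * c) c1 c2 0 0"
  "sl11_model \<O> c1 c2 d1 d2 c d sl11_D = field_map \<O> 0 (d2 * d) (- d1 * d) d1 d2 0 0"
  by (simp_all add: sl11_model_def axis_def)

lemma sl11_model_even:
  assumes "sl11_homogeneous p X" "even p"
  shows "sl11_model \<O> c1 c2 d1 d2 c d X = field_map \<O> (X $ Hplus) 0 0 0 0 0 0"
  using assms by (simp add: sl11_model_def sl11_homogeneous_def)

lemma sl11_model_odd: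
  assumes "sl11_homogeneous p X" "odd p"
  shows "sl11_model \<O> c1 c2 d1 d2 c d X = field_map \<O> 0
       (X $ Odd Cgen * (c2 * c) + X $ Odd Dgen * (d2 * d))
       (X $ Odd Cgen * (- c1 * c) + X $ Odd Dgen * (- d1 * d))
       (X $ Odd Cgen * c1 + X $ Odd Dgen * d1)
       (X $ Odd Cgen * c2 + X $ Odd Dgen * d2) 0 0"
  using assms by (simp add: sl11_model_def sl11_homogeneous_def)

text \<open>Only two odd arguments give a nonzero supercommutator, and there the multiple of \<open>\<partial>\<^sub>x\<close> is the
bilinear form of \<open>[C, D] = H\<close> times the left-hand side of the assumption.\<close>

lemma sl11_model_bracket:
  assumes cond: "(c1 * d2 - c2 * d1) * (d - c) = 1"
    and X: "sl11_homogeneous p X" and Y: "sl11_homogeneous q Y"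
    and U: "open U" and s: "s \<in> sections \<O> U"
  defines "\<rho> \<equiv> sl11_model \<O> c1 c2 d1 d2 c d"
  shows "\<rho> (sl11_bracket X Y) U s x =
    \<rho> X U (\<rho> Y U s) x - (- 1) ^ (p * q) *s \<rho> Y U (\<rho> X U s) x"
proof (cases "x \<in> U")
  case False
  then show ?thesis by (simp add: \<rho>_def sl11_model_def field_map_outside)
next
  case x: True
  have B: "\<rho> (sl11_bracket X Y) U s x =
      (X $ Odd Cgen * Y $ Odd Dgen + X $ Odd Dgen * Y $ Odd Cgen) *s sderiv s x"
    by (simp add: \<rho>_def sl11_model_def sl11_bracket_def axis_def field_map_apply[OF U s x] even_field_value)
  consider "even p" "even q" | "even p" "odd q" | "odd p" "even q" | "odd p" "odd q" by blast
  then show ?thesis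
  proof cases
    case 1
    then show ?thesis
      unfolding B using X Y by (simp add: \<rho>_def sl11_model_even[OF X] sl11_model_even[OF Y] sl11_homogeneous_def
          field_map_compose[OF U s x] even_field_value algebra_simps)
  next
    case 2
    then show ?thesis
      unfolding B using X Y by (simp add: \<rho>_def sl11_model_even[OF X] sl11_model_odd[OF Y] sl11_homogeneous_def
          field_map_compose[OF U s x] even_field_value field_value_scale)
  next
    case 3
    then show ?thesis
      unfolding B using X Y by (simp add: \<rho>_def sl11_model_odd[OF X] sl11_model_even[OF Y] sl11_homogeneous_def
          field_map_compose[OF U s x] even_field_value field_value_scale)
  next
    case 4
    let ?x = "X $ Odd Cgen" and ?y = "X $ Odd Dgen" and ?x' = "Y $ Odd Cgen" and ?y' = "Y $ Odd Dgen"
    have "(?x * (c2 * c) + ?y * (d2 * d)) * (?x' * c1 + ?y' * d1) +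
        (?x * (- c1 * c) + ?y * (- d1 * d)) * (?x' * c2 + ?y' * d2) +
        (?x' * (c2 * c) + ?y' * (d2 * d)) * (?x * c1 + ?y * d1) +
        (?x' * (- c1 * c) + ?y' * (- d1 * d)) * (?x * c2 + ?y * d2) =
      (?x * ?y' + ?y * ?x') * ((c1 * d2 - c2 * d1) * (d - c))"
      by (simp add: algebra_simps)
    also have "\<dots> = ?x * ?y' + ?y * ?x'" by (simp only: cond mult_1_right)
    finally have k: "(?x * (c2 * c) + ?y * (d2 * d)) * (?x' * c1 + ?y' * d1) +
        (?x * (- c1 * c) + ?y * (- d1 * d)) * (?x' * c2 + ?y' * d2) +
        (?x' * (c2 * c) + ?y' * (d2 * d)) * (?x * c1 + ?y * d1) +
        (?x' * (- c1 * c) + ?y' * (- d1 * d)) * (?x * c2 + ?y * d2) = ?x * ?y' + ?y * ?x'" .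
    have "(- 1 :: 'k) ^ (p * q) = - 1" using 4 by simp
    then have "\<rho> X U (\<rho> Y U s) x - (- 1) ^ (p * q) *s \<rho> Y U (\<rho> X U s) x =
        \<rho> X U (\<rho> Y U s) x + \<rho> Y U (\<rho> X U s) x"
      by (simp add: vec_eq_iff)
    also have "\<dots> = (?x * ?y' + ?y * ?x') *s sderiv s x"
      unfolding \<rho>_def sl11_model_odd[OF X 4(1)] sl11_model_odd[OF Y 4(2)] field_map_compose[OF U s x]
        supercommutator_odd_fields k ..
    finally show ?thesis by (simp only: B)
  qed
qed

lemma sl11_model_representation:
  assumes "(c1 * d2 - c2 * d1) * (d - c) = 1"
  shows "sl11_representation \<O> (sl11_model \<O> c1 c2 d1 d2 c d)"
  unfolding sl11_representation_def
proof (intro conjI allI impI ballI ext)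
  fix X Y :: "'k sl11" and U s x
  show "sl11_model \<O> c1 c2 d1 d2 c d (X + Y) U s x =
      sl11_model \<O> c1 c2 d1 d2 c d X U s x + sl11_model \<O> c1 c2 d1 d2 c d Y U s x"
    unfolding sl11_model_def field_map_coefficients_add[symmetric]
    by (simp add: algebra_simps)
next
  fix k and X :: "'k sl11" and U s x
  show "sl11_model \<O> c1 c2 d1 d2 c d (k *s X) U s x = k *s sl11_model \<O> c1 c2 d1 d2 c d X U s x"
    unfolding sl11_model_def field_map_coefficients_scale[symmetric]
    by (simp add: algebra_simps)
next
  fix p and X :: "'k sl11" assume "sl11_homogeneous p X"
  then show "superderivation \<O> p (sl11_model \<O> c1 c2 d1 d2 c d X)"
    by (cases "even p") (simp_all add: sl11_model_even sl11_model_odd superderivation_field_map_even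
        superderivation_field_map_odd)
next
  fix p q and X Y :: "'k sl11" and U s x
  assume "sl11_homogeneous p X" "sl11_homogeneous q Y" "open U" "s \<in> sections \<O> U"
  then show "sl11_model \<O> c1 c2 d1 d2 c d (sl11_bracket X Y) U s x =
      sl11_model \<O> c1 c2 d1 d2 c d X U (sl11_model \<O> c1 c2 d1 d2 c d Y U s) x -
      (- 1) ^ (p * q) *s sl11_model \<O> c1 c2 d1 d2 c d Y U (sl11_model \<O> c1 c2 d1 d2 c d X U s) x"
    by (rule sl11_model_bracket[OF assms])
qed

text \<open>For the condition on invariants: a section killed by \<open>H\<close> has constant components, and \<open>C\<close> and \<open>D\<close>
act on it through \<open>c1 \<partial>\<^sub>1 + c2 \<partial>\<^sub>2\<close> and \<open>d1 \<partial>\<^sub>1 + d2 \<partial>\<^sub>2\<close>. The determinant is nonzero, so both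
\<open>\<partial>\<^sub>1\<close> and \<open>\<partial>\<^sub>2\<close> kill an invariant section, which leaves only its scalar component.\<close>

lemma sl11_model_RTLSG:
  assumes cond: "(c1 * d2 - c2 * d1) * (d - c) = 1"
  shows "sl11_RTLSG \<O> (sl11_model \<O> c1 c2 d1 d2 c d)"
  unfolding sl11_RTLSG_def
proof (intro conjI allI impI ballI sl11_model_representation[OF cond])
  fix X :: "'k sl11" and U :: "'k set" and f
  assume X: "sl11_homogeneous 0 X" and U: "open U" and "f \<in> \<O> U"
  then have f: "smooth_on U f" by (simp add: mem_iff_smooth_on)
  have "sderiv (\<lambda>y. f y *s ext_one) x = deriv f x *s ext_one" if "x \<in> U" for x
    by (rule sderiv_eqI)
       (auto intro!: derivative_eq_intros smooth_on_has_derivative[OF f that])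
  then show "sl11_model \<O> c1 c2 d1 d2 c d X U (restr U (\<lambda>x. f x *s ext_one)) =
      restr U (\<lambda>x. (X $ Hplus * deriv f x) *s ext_one)"
    unfolding sl11_model_even[OF X even_zero]
    using function_section[OF U f, of ext_one]
    by (auto simp: field_map_def U restr_def even_field_value
        sderiv_restr[OF U, unfolded restr_def] vector_smult_assoc)
next
  fix X :: "'k sl11" and U :: "'k set" and i
  assume X: "sl11_homogeneous 0 X" and U: "open U"
  have "sl11_bracket (axis (Odd j) 1) X $ Odd i = 0" for j
    by (simp add: sl11_bracket_def axis_def)
  then show "sl11_model \<O> c1 c2 d1 d2 c d X U (restr U (\<lambda>x. ext_gen i)) =
      restr U (\<lambda>x. \<Sum>j\<in>UNIV. (sl11_bracket (axis (Odd j) 1) X $ Odd i) *s ext_gen j)"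
    unfolding sl11_model_even[OF X even_zero]
    by (auto simp: field_map_def restr_def even_field_value sderiv_restr[OF U, unfolded restr_def])
next
  fix s assume s: "s \<in> sections \<O> UNIV"
    and inv: "\<forall>X. sl11_model \<O> c1 c2 d1 d2 c d X UNIV s = (\<lambda>x. 0)"
  have "sderiv s x = 0" for x
    using fun_cong[OF inv[rule_format, of sl11_H], of x]
    by (simp add: sl11_model_basis field_map_apply s even_field_value)
  then obtain v where v: "s = (\<lambda>x. v)" using sderiv_zero_imp_const[OF s] by blast
  have C: "field_value 0 (c2 * c) (- c1 * c) c1 c2 0 0 v 0 = 0"
    and D: "field_value 0 (d2 * d) (- d1 * d) d1 d2 0 0 v 0 = 0"
    using inv[rule_format, of sl11_C] inv[rule_format, of sl11_D]
    unfolding v sl11_model_basis field_map_const by (simp_all add: fun_eq_iff)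
  have det: "c1 * d2 - c2 * d1 \<noteq> 0" using cond by auto
  have lin: "c1 * v $ {Cgen} + c2 * v $ {Dgen} = 0" "d1 * v $ {Cgen} + d2 * v $ {Dgen} = 0"
    using C D by (simp_all add: ext_eq_iff field_value_components)
  have "(c1 * d2 - c2 * d1) * v $ {Cgen} =
      d2 * (c1 * v $ {Cgen} + c2 * v $ {Dgen}) - c2 * (d1 * v $ {Cgen} + d2 * v $ {Dgen})"
    by (simp add: algebra_simps)
  then have "v $ {Cgen} = 0" using det by (simp add: lin)
  moreover have "(c1 * d2 - c2 * d1) * v $ {Dgen} =
      c1 * (d1 * v $ {Cgen} + d2 * v $ {Dgen}) - d1 * (c1 * v $ {Cgen} + c2 * v $ {Dgen})"
    by (simp add: algebra_simps)
  then have "v $ {Dgen} = 0" using det by (simp add: lin)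
  moreover have "v $ {Cgen, Dgen} = 0"
    using C det by (auto simp: ext_eq_iff field_value_components)
  ultimately have "v = v $ {} *s ext_one" by (simp add: ext_simps)
  then show "\<exists>k. s = (\<lambda>x. k *s ext_one)" unfolding v by metis
qed

section \<open>The parametrization\<close>

lemma RTLSG_determined_by_parameters:
  assumes "sl11_RTLSG \<O> \<rho>" "sl11_RTLSG \<O> \<rho>'" "sl11_parameters \<rho> t" "sl11_parameters \<rho>' t"
  shows "\<rho> = \<rho>'"
proof -
  obtain c1 c2 d1 d2 c d where t: "t = (c1, c2, d1, d2, c, d)" by (cases t)
  have basis: "\<sigma> sl11_H = field_map \<O> 1 0 0 0 0 0 0"
      "\<sigma> sl11_C = field_map \<O> 0 (c2 * c) (- c1 * c) c1 c2 0 0"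
      "\<sigma> sl11_D = field_map \<O> 0 (d2 * d) (- d1 * d) d1 d2 0 0"
    if \<sigma>: "sl11_RTLSG \<O> \<sigma>" "sl11_parameters \<sigma> t" for \<sigma>
  proof -
    obtain a b p1 p2 a' b' q1 q2 where nf: "\<sigma> sl11_H = field_map \<O> 1 0 0 0 0 0 0"
      "\<sigma> sl11_C = field_map \<O> 0 a b p1 p2 0 0" "\<sigma> sl11_D = field_map \<O> 0 a' b' q1 q2 0 0"
      by (rule RTLSG_normal_form[OF \<sigma>(1)], rule that)
    have "c1 = p1 \<and> c2 = p2 \<and> d1 = q1 \<and> d2 = q2 \<and>
        a = p2 * c \<and> b = - p1 * c \<and> a' = q2 * d \<and> b' = - q1 * d"
      using \<sigma>(2) unfolding t sl11_parameters_iff[OF nf(2,3)] .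
    then show "\<sigma> sl11_H = field_map \<O> 1 0 0 0 0 0 0"
      "\<sigma> sl11_C = field_map \<O> 0 (c2 * c) (- c1 * c) c1 c2 0 0"
      "\<sigma> sl11_D = field_map \<O> 0 (d2 * d) (- d1 * d) d1 d2 0 0"
      by (simp_all add: nf)
  qed
  have expand: "\<sigma> X U s x = X $ Hplus *s \<sigma> sl11_H U s x +
      (X $ Odd Cgen *s \<sigma> sl11_C U s x + X $ Odd Dgen *s \<sigma> sl11_D U s x)"
    if "sl11_RTLSG \<O> \<sigma>" for \<sigma> X U s x
  proof -
    have "\<sigma> (X + Y) U s x = \<sigma> X U s x + \<sigma> Y U s x" "\<sigma> (a *s X) U s x = a *s \<sigma> X U s x" for X Y a
      using that by (simp_all add: sl11_RTLSG_def sl11_representation_def)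
    then show ?thesis by (subst sl11_expansion[of X]) simp
  qed
  show ?thesis
  proof (intro ext)
    fix X U s x
    show "\<rho> X U s x = \<rho>' X U s x"
      using expand[OF assms(1), of X U s x] expand[OF assms(2), of X U s x]
      unfolding basis[OF assms(1,3)] basis[OF assms(2,4)] by simp
  qed
qed

lemma RTLSG_parametrization:
  "(\<forall>\<rho>. sl11_RTLSG \<O> \<rho> \<longrightarrow>
      (\<exists>!t. sl11_parameters \<rho> t) \<and> (\<forall>t. sl11_parameters \<rho> t \<longrightarrow> sl11_condition t)) \<and>
   (\<forall>t. sl11_condition t \<longrightarrow> (\<exists>!\<rho>. sl11_RTLSG \<O> \<rho> \<and> sl11_parameters \<rho> t))"
proof (intro conjI allI impI)
  fix \<rho> assume \<rho>: "sl11_RTLSG \<O> \<rho>"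
  obtain a b p1 p2 a' b' q1 q2 where nf:
    "\<rho> sl11_C = field_map \<O> 0 a b p1 p2 0 0" "\<rho> sl11_D = field_map \<O> 0 a' b' q1 q2 0 0"
    "p1 \<noteq> 0 \<or> p2 \<noteq> 0" "q1 \<noteq> 0 \<or> q2 \<noteq> 0" "a * p1 + b * p2 = 0" "a' * q1 + b' * q2 = 0"
    "a * q1 + b * q2 + a' * p1 + b' * p2 = 1"
    by (rule RTLSG_normal_form[OF \<rho>], rule that)
  note params = sl11_parameters_iff[OF nf(1,2)]
  obtain c where c: "a = p2 * c" "b = - p1 * c" and c_unique: "\<And>e. a = p2 * e \<Longrightarrow> b = - p1 * e \<Longrightarrow> e = c"
    using orthogonal_pair_unique_multiple[OF nf(3,5)] by blast
  obtain d where d: "a' = q2 * d" "b' = - q1 * d" and d_unique: "\<And>e. a' = q2 * e \<Longrightarrow> b' = - q1 * e \<Longrightarrow> e = d"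
    using orthogonal_pair_unique_multiple[OF nf(4,6)] by blast
  have t: "sl11_parameters \<rho> t \<longleftrightarrow> t = (p1, p2, q1, q2, c, d)" for t
  proof (cases t)
    case (fields c1 c2 d1 d2 e f)
    then show ?thesis using c d c_unique[of e] d_unique[of f] by (auto simp: params)
  qed
  show "\<exists>!t. sl11_parameters \<rho> t" by (simp add: t)
  fix t assume "sl11_parameters \<rho> t"
  then have "t = (p1, p2, q1, q2, c, d)" by (simp add: t)
  moreover have "(p1 * q2 - p2 * q1) * (d - c) = a * q1 + b * q2 + a' * p1 + b' * p2"
    by (simp add: c d algebra_simps)
  ultimately show "sl11_condition t" by (simp add: sl11_condition_iff nf(7))
next
  fix t :: "'k \<times> 'k \<times> 'k \<times> 'k \<times> 'k \<times> 'k" assume cond: "sl11_condition t"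
  obtain c1 c2 d1 d2 c d where t: "t = (c1, c2, d1, d2, c, d)" by (cases t)
  have "sl11_RTLSG \<O> (sl11_model \<O> c1 c2 d1 d2 c d)"
    by (rule sl11_model_RTLSG) (use cond in \<open>simp add: t sl11_condition_iff\<close>)
  moreover have "sl11_parameters (sl11_model \<O> c1 c2 d1 d2 c d) t"
    unfolding t by (simp add: sl11_parameters_iff[OF sl11_model_basis(2,3)])
  ultimately show "\<exists>!\<rho>. sl11_RTLSG \<O> \<rho> \<and> sl11_parameters \<rho> t"
    using RTLSG_determined_by_parameters by blast
qed

end

theorem proposition3:
  shows
   "((\<forall>\<rho>. sl11_RTLSG smooth_functions \<rho> \<longrightarrow>
        (\<exists>!t. sl11_parameters \<rho> t) \<and> (\<forall>t. sl11_parameters \<rho> t \<longrightarrow> sl11_condition t)) \<and>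
     (\<forall>t. sl11_condition t \<longrightarrow>
        (\<exists>!\<rho>. sl11_RTLSG smooth_functions \<rho> \<and> sl11_parameters \<rho> t))) \<and>
    ((\<forall>\<rho>. sl11_RTLSG holomorphic_functions \<rho> \<longrightarrow>
        (\<exists>!t. sl11_parameters \<rho> t) \<and> (\<forall>t. sl11_parameters \<rho> t \<longrightarrow> sl11_condition t)) \<and>
     (\<forall>t. sl11_condition t \<longrightarrow>
        (\<exists>!\<rho>. sl11_RTLSG holomorphic_functions \<rho> \<and> sl11_parameters \<rho> t)))"
proof (rule conjI)
  interpret smooth_function_sheaf smooth_functions
    by unfold_locales (simp add: smooth_functions_def smooth_on_def)
  show "(\<forall>\<rho>. sl11_RTLSG smooth_functions \<rho> \<longrightarrow>
        (\<exists>!t. sl11_parameters \<rho> t) \<and> (\<forall>t. sl11_parameters \<rho> t \<longrightarrow> sl11_condition t)) \<and>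
     (\<forall>t. sl11_condition t \<longrightarrow>
        (\<exists>!\<rho>. sl11_RTLSG smooth_functions \<rho> \<and> sl11_parameters \<rho> t))"
    by (rule RTLSG_parametrization)
next
  interpret smooth_function_sheaf holomorphic_functions
    by unfold_locales (simp add: holomorphic_functions_def holomorphic_on_iff_smooth_on)
  show "(\<forall>\<rho>. sl11_RTLSG holomorphic_functions \<rho> \<longrightarrow>
        (\<exists>!t. sl11_parameters \<rho> t) \<and> (\<forall>t. sl11_parameters \<rho> t \<longrightarrow> sl11_condition t)) \<and>
     (\<forall>t. sl11_condition t \<longrightarrow>
        (\<exists>!\<rho>. sl11_RTLSG holomorphic_functions \<rho> \<and> sl11_parameters \<rho> t))"
    by (rule RTLSG_parametrization)
qed

end
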